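(* Let $\mu_1,\mu_3$ be probability measures on $\mathbb{R}$ such that $\mu_1$ has non-negative support and admits moments of order $4$, and $\mu_3$ admits moments of order $2$ and has a non-zero first moment; suppose (without loss of generality) that the first moments of $\mu_1$ and $\mu_3$ are equal to one. Then there exist $K>0$ and unique functions $\omega_1,\omega_3:\mathbb{C}_K\to\mathbb{C}^+$ such that: (1) The constant $K$ depends only on the respective variances $\sigma_1^2$ and $\sigma_3^2$ of $\mu_1$ and $\mu_3$ and on the Jacobi coefficients $\beta_1,\gamma_1$ of $\mu_1$, and one can choose $$K\le\left[6\Big(2\sigma_1^2+\sqrt{5\sigma_1^4+2\sigma_3^2\sigma_1^2}\Big)\right]\vee\left[R+\tfrac32\sqrt{R^2+4R\sigma_3^2}\right],\qquad R=2\left(\sqrt{\gamma_1}\vee\beta_1\right).$$ (2) If $\mu_2$ is such that $\mu_1\boxtimes\mu_2=\mu_3$, then $F_{\mu_2}(z)=F_{\mu_3}(\omega_3(z))\,z\,\omega_3(z)^{-1}$ for $z\in\mathbb{C}_K$. (3) Put $h_1(w)=w-F_{\mu_1}(w)$, $\tilde h_3(w)=w^{-2}[w-F_{\mu_3}(w)]$ and $T_z(w)=z\,h_1\big(\tilde h_3(w)^{-1}z^{-1}\big)$. Then for $z\in\mathbb{C}_K$ and any $w\in D(z,\frac{\Im z}{5})$, the iterates $T_z^{\circ n}(w)$ converge to $\omega_3(z)$ as $n\to\infty$. (4) $\omega_1(z)=\dfrac{1}{z\,\tilde h_3(\omega_3(z))}$ for all $z\in\mathbb{C}_K$.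
   Context: $\mathbb{C}^+$ is the open upper half-plane; for real $\sigma$, $\mathbb{C}_\sigma=\{z:\Im z>\sigma\}$; $D(z,r)$ is the open disc of center $z$ and radius $r$; $a\vee b=\max(a,b)$; $T^{\circ n}$ is the $n$-fold composition. For a probability measure $\mu$ on $\mathbb{R}$, $G_\mu(z)=\int\frac{1}{z-t}d\mu(t)$ and $F_\mu=1/G_\mu$, viewed on $\mathbb{C}^+$; for $\mu_1$, supported in $[0,\infty)$, $F_{\mu_1}$ and hence $h_1$ are considered on the larger domain $\mathbb{C}\setminus[0,\infty)$ by the same formula. Jacobi coefficients: since $\mu_1$ has finite fourth moment, there are $\beta_0,\beta_1\in\mathbb{R}$, $\gamma_0,\gamma_1\ge0$ and a probability measure $\nu$ with $$G_{\mu_1}(z)=\cfrac{1}{z-\beta_0-\cfrac{\gamma_0}{z-\beta_1-\gamma_1G_\nu(z)}}$$ (so $\beta_0$ is the mean and $\gamma_0$ the variance of $\mu_1$). $\boxtimes$ is the free multiplicative convolution of a probability measure on $[0,\infty)$ and a probability measure on $\mathbb{R}$ with finite second moment and non-zero first moment: it is the probability measure determined by $\Sigma_{\mu_1\boxtimes\mu_2}=\Sigma_{\mu_1}\Sigma_{\mu_2}$ near $0$, where $\eta_\mu(w)=w[w^{-1}-F_\mu(w^{-1})]$ and $\Sigma_\mu(z)=\eta_\mu^{\langle-1\rangle}(z)/z$ ($\eta_\mu^{\langle -1\rangle}$ is the compositional inverse).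
   Formalization: ω1 takes values in C∖[0,∞) rather than C^+ (false for μ1=δ_1, F_{μ3}(z)=z−1−1/(z−1+c), c large), and the upper bound on K is asserted only when it is positive (it can be 0 when μ1 is a point mass, contradicting K>0). *)

theory Defs
  imports "HOL-Probability.Probability" "HOL-Complex_Analysis.Complex_Analysis"
begin

definition mean :: "real measure \<Rightarrow> real" where
  "mean \<mu> = (\<integral>x. x \<partial>\<mu>)"

definition var :: "real measure \<Rightarrow> real" where
  "var \<mu> = (\<integral>x. (x - mean \<mu>)\<^sup>2 \<partial>\<mu>)"

definition halfplane :: "real \<Rightarrow> complex set" where
  "halfplane \<sigma> = {z. Im z > \<sigma>}"

text \<open>The transforms below are given by their formulas on all of the complex plane; they are
  meaningful off the support of the measure.  In particular \<open>F\<close> and \<open>h\<close> of a measure on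
  \<open>[0,\<infinity>)\<close> are meaningful off \<open>[0,\<infinity>)\<close>.\<close>

definition G_transform :: "real measure \<Rightarrow> complex \<Rightarrow> complex" where
  "G_transform \<mu> z = (\<integral>t. 1 / (z - complex_of_real t) \<partial>\<mu>)"

definition F_transform :: "real measure \<Rightarrow> complex \<Rightarrow> complex" where
  "F_transform \<mu> z = 1 / G_transform \<mu> z"

definition h_fun :: "real measure \<Rightarrow> complex \<Rightarrow> complex" where
  "h_fun \<mu> w = w - F_transform \<mu> w"

definition h_tilde :: "real measure \<Rightarrow> complex \<Rightarrow> complex" where
  "h_tilde \<mu> w = (w - F_transform \<mu> w) / w\<^sup>2"

definition T_map :: "real measure \<Rightarrow> real measure \<Rightarrow> complex \<Rightarrow> complex \<Rightarrow> complex" where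
  "T_map \<mu>1 \<mu>3 z w = z * h_fun \<mu>1 (1 / (h_tilde \<mu>3 w * z))"

text \<open>If \<open>\<gamma>0 = 0\<close> (that is, \<open>\<mu>\<close> is a point mass), then \<open>\<beta>1\<close>, \<open>\<gamma>1\<close> and \<open>\<nu>\<close> are arbitrary;
  hence a relation rather than a function of \<open>\<mu>\<close>.\<close>

definition jacobi_coeffs ::
    "real measure \<Rightarrow> real \<Rightarrow> real \<Rightarrow> real \<Rightarrow> real \<Rightarrow> bool" where
  "jacobi_coeffs \<mu> \<beta>0 \<gamma>0 \<beta>1 \<gamma>1 \<longleftrightarrow>
     \<gamma>0 \<ge> 0 \<and> \<gamma>1 \<ge> 0 \<and>
     (\<exists>\<nu>. real_distribution \<nu> \<and>
        (\<forall>z\<in>halfplane 0.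
           G_transform \<mu> z =
             1 / (z - \<beta>0 - \<gamma>0 / (z - \<beta>1 - \<gamma>1 * G_transform \<nu> z))))"

definition eta :: "real measure \<Rightarrow> complex \<Rightarrow> complex" where
  "eta \<mu> w = w * (1 / w - F_transform \<mu> (1 / w))"

text \<open>The truncated double cone around the imaginary axis with vertex \<open>0\<close>; it contains no
  real point.  Both halves are used because, for a measure with finite second moment and mean
  \<open>m \<noteq> 0\<close>, \<open>eta \<mu> w\<close> behaves like \<open>m * w\<close> as \<open>w\<close> tends to \<open>0\<close> nontangentially, so for \<open>m < 0\<close>
  it exchanges the two half-planes.\<close>

definition cone :: "real \<Rightarrow> real \<Rightarrow> complex set" where
  "cone \<alpha> \<epsilon> = {w. \<bar>Re w\<bar> < \<alpha> * \<bar>Im w\<bar> \<and> norm w < \<epsilon>}"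

text \<open>\<open>D\<close> is a domain on which \<open>eta \<mu>\<close> is injective.\<close>

definition Sigma_transform :: "real measure \<Rightarrow> complex set \<Rightarrow> complex \<Rightarrow> complex" where
  "Sigma_transform \<mu> D z = inv_into D (eta \<mu>) z / z"

text \<open>\<open>\<mu> = \<mu>1 \<boxtimes> \<mu>2\<close>, for a probability measure \<open>\<mu>1\<close> on \<open>[0,\<infinity>)\<close> and a probability measure \<open>\<mu>2\<close> on
  the line, both with finite second moment and non-zero mean.  Such measures need not have
  compact support, so \<open>eta\<close> need not extend analytically to \<open>0\<close>, and ``near \<open>0\<close>'' means
  in a truncated cone with vertex \<open>0\<close>.  The choice of cones is immaterial, by analytic
  continuation.\<close>

definition is_free_mult_conv ::
    "real measure \<Rightarrow> real measure \<Rightarrow> real measure \<Rightarrow> bool" where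
  "is_free_mult_conv \<mu>1 \<mu>2 \<mu> \<longleftrightarrow>
     real_distribution \<mu> \<and>
     (\<exists>\<alpha>>0. \<exists>\<epsilon>>0. \<exists>\<alpha>'>0. \<exists>\<epsilon>'>0.
        (\<forall>\<rho>\<in>{\<mu>1, \<mu>2, \<mu>}.
           inj_on (eta \<rho>) (cone \<alpha> \<epsilon>) \<and> cone \<alpha>' \<epsilon>' \<subseteq> eta \<rho> ` cone \<alpha> \<epsilon>) \<and>
        (\<forall>z\<in>cone \<alpha>' \<epsilon>'.
           Sigma_transform \<mu> (cone \<alpha> \<epsilon>) z =
             Sigma_transform \<mu>1 (cone \<alpha> \<epsilon>) z * Sigma_transform \<mu>2 (cone \<alpha> \<epsilon>) z))"

definition R_const :: "real \<Rightarrow> real \<Rightarrow> real" where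
  "R_const \<beta>1 \<gamma>1 = 2 * max (sqrt \<gamma>1) \<beta>1"

text \<open>\<open>v1\<close> and \<open>v3\<close> are the variances \<open>\<sigma>1\<^sup>2\<close> and \<open>\<sigma>3\<^sup>2\<close>.
  For admissible parameters the bound is non-negative; it vanishes only if \<open>v1 = 0\<close>,
  \<open>\<gamma>1 = 0\<close> and \<open>\<beta>1 \<le> 0\<close>, so only for a point mass \<open>\<mu>1\<close> with a degenerate choice of its
  arbitrary coefficients \<open>\<beta>1\<close>, \<open>\<gamma>1\<close>.\<close>

definition K_bound :: "real \<Rightarrow> real \<Rightarrow> real \<Rightarrow> real \<Rightarrow> real" where
  "K_bound v1 v3 \<beta>1 \<gamma>1 =
     (let R = R_const \<beta>1 \<gamma>1 in
      max (6 * (2 * v1 + sqrt (5 * v1\<^sup>2 + 2 * v3 * v1)))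
          (R + 3 / 2 * sqrt (R\<^sup>2 + 4 * R * v3)))"

end

theory Submission
  imports Defs
begin

text \<open>Write \<open>y = Im z\<close> and \<open>h\<^sub>3 w = w - F\<^sub>\<mu>\<^sub>3 w\<close>.  The function \<open>\<omega>\<^sub>3(z)\<close> is the fixed point of \<open>T\<^sub>z(w) = z h\<^sub>1(u)\<close>, where
  \<open>u = (w\<^sup>2/z) / h\<^sub>3 w\<close>.  Since \<open>\<mu>\<^sub>1\<close> has mean \<open>1\<close>, \<open>T\<^sub>z(w) - z = z W\<^sub>1(u)\<close> with
  \<open>W\<^sub>1 u = u - 1 - F\<^sub>\<mu>\<^sub>1 u\<close>, a function of size about \<open>\<sigma>\<^sub>1\<^sup>2 / \<bar>u\<bar>\<close>.  The heart of the proof is that for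
  \<open>y > K\<close> the map \<open>T\<^sub>z\<close> sends the disc of radius \<open>y/5\<close> about \<open>z\<close> into the concentric disc of radius \<open>y/9\<close>
  (\<open>T_map_displacement\<close>).

  For this one needs bounds on \<open>W\<^sub>1\<close> and on \<open>W\<^sub>3 w = h\<^sub>3 w - 1\<close>.  They come from an identity that a
  Schur complement provides (\<open>h_centred_resolvent\<close>): \<open>W\<close> at \<open>u\<close> equals \<open>u\<^sup>* N - m\<close>, with \<open>u\<^sup>*\<close> the conjugate and with real \<open>N \<ge> 0\<close>
  and \<open>m\<close>, where \<open>\<bar>W\<bar>\<^sup>2 \<le> \<sigma>\<^sup>2 N\<close>, and \<open>m \<ge> 0\<close> if the measure lives on \<open>[0,\<infinity>)\<close>.  In the upper
  half-plane this puts \<open>W\<^sub>3 w\<close> into a disc that touches the real line from below at \<open>0\<close>, with diameter \<open>\<sigma>\<^sub>3\<^sup>2 / Im w\<close>.  So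
  \<open>h\<^sub>3 w\<close> is in the closed lower half-plane, which keeps \<open>u\<close> away from \<open>[0,\<infinity>)\<close>, and its modulus \<open>N\<^sub>3\<close> satisfies
  \<open>N\<^sub>3\<^sup>2 \<le> 1 + (\<sigma>\<^sub>3\<^sup>2 / Im w) N\<^sub>3\<close>.  The two terms of the bound on \<open>K\<close> are made so that, for \<open>\<sigma>\<^sub>1\<^sup>2 > 0\<close>,
  this inequality gives \<open>y / N\<^sub>3 \<ge> 25 \<sigma>\<^sub>1\<^sup>2\<close> and \<open>y / N\<^sub>3 \<ge> 5 R / 2\<close> (\<open>K_choice_less_imp\<close>, \<open>threshold\<close>).  In the left half-plane the identity gives
  \<open>\<bar>W\<^sub>1 u\<bar> \<le> \<sigma>\<^sub>1\<^sup>2 / \<bar>u\<bar>\<close>; in the right half-plane the continued fraction takes over, where \<open>\<beta>\<^sub>1\<close> and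
  \<open>\<gamma>\<^sub>1 / \<bar>Im u\<bar>\<close> are small in comparison with \<open>\<bar>u\<bar>\<close> (\<open>T_arg_estimates\<close>).

  A holomorphic map of a disc into a smaller concentric disc has a unique fixed point, to which
  all iterates converge at a geometric rate that depends on the ratio of the radii alone
  (\<open>iterates_disc_converge\<close>).  This gives existence, uniqueness and convergence of the iterates, and because the rate does not
  depend on \<open>z\<close>, \<open>\<omega>\<^sub>3\<close> is holomorphic.

  If \<open>\<mu>\<^sub>1 \<boxtimes> \<mu>\<^sub>2 = \<mu>\<^sub>3\<close>, then for \<open>z\<close> high up on the imaginary axis the fixed-point equation identifies
  \<open>1/\<omega>\<^sub>1\<close>, \<open>1/\<omega>\<^sub>3\<close> and \<open>1/z\<close> as the values at one point of the inverses of the three functions \<open>\<eta>\<close>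
  (\<open>deconvolution_imaginary_axis\<close>); this is the formula for \<open>F\<^sub>\<mu>\<^sub>2\<close> there, and it extends to the whole half-plane by
  the identity theorem.\<close>

section \<open>Iteration of a holomorphic map into a smaller concentric disc\<close>

text \<open>The pseudo-hyperbolic distance of two points of the disc of radius \<open>r\<close> is largest for \<open>r\<close> and \<open>-r\<close>.\<close>
lemma Moebius_bound:
  fixes p x :: complex
  assumes "norm p \<le> r" "norm x \<le> r" "0 \<le> r" "r < 1"
  shows "norm (Moebius_function 0 p x) \<le> 2 * r / (1 + r\<^sup>2)"
proof -
  have px: "norm p * norm x \<le> r\<^sup>2"
    using assms by (simp add: power2_eq_square mult_mono)
  have ne: "1 - cnj p * x \<noteq> 0"
  proof
    assume "1 - cnj p * x = 0"
    then have "norm (cnj p * x) = 1" by simp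
    then have "norm p * norm x = 1" by (simp add: norm_mult)
    with px have "1 \<le> r\<^sup>2" by simp
    with assms show False by (simp add: abs_square_less_1 flip: not_less)
  qed
  define a b c where "a = (norm p)\<^sup>2" and "b = (norm x)\<^sup>2" and "c = (norm (1 - cnj p * x))\<^sup>2"
  have id: "(norm (x - p))\<^sup>2 = c - (1 - a) * (1 - b)"
    unfolding a_def b_def c_def cmod_power2 by (simp add: algebra_simps power2_eq_square)
  have ab: "a \<le> r\<^sup>2" "b \<le> r\<^sup>2" "0 \<le> a" "0 \<le> b" using assms by (auto simp: a_def b_def power_mono)
  have r1: "r\<^sup>2 < 1" using assms by (simp add: abs_square_less_1)
  have "norm (1 - cnj p * x) \<le> 1 + r\<^sup>2"
    using norm_triangle_ineq4[of 1 "cnj p * x"] px by (simp add: norm_mult)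
  then have c: "c \<le> (1 + r\<^sup>2)\<^sup>2" unfolding c_def by (intro power_mono) auto
  have c0: "c > 0" using ne by (simp add: c_def)
  have low: "(1 - r\<^sup>2)\<^sup>2 \<le> (1 - a) * (1 - b)"
    unfolding power2_eq_square[of "1 - r\<^sup>2"] using ab r1 by (intro mult_mono) auto
  have "(norm (Moebius_function 0 p x))\<^sup>2 = (norm (x - p))\<^sup>2 / c"
    by (simp add: Moebius_function_simple norm_divide c_def power_divide)
  also have "\<dots> \<le> 1 - (1 - r\<^sup>2)\<^sup>2 / c"
    using divide_right_mono[OF low, of c] c0 by (simp add: id diff_divide_distrib)
  also have "\<dots> \<le> 1 - (1 - r\<^sup>2)\<^sup>2 / (1 + r\<^sup>2)\<^sup>2"
    using c c0 by (intro diff_left_mono divide_left_mono mult_pos_pos) (auto simp: add_pos_nonneg)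
  also have "\<dots> = (2 * r / (1 + r\<^sup>2))\<^sup>2"
  proof -
    have "1 + r\<^sup>2 \<noteq> 0" by (metis add_pos_nonneg less_irrefl zero_le_power2 zero_less_one)
    then have "1 - (1 - r\<^sup>2)\<^sup>2 / (1 + r\<^sup>2)\<^sup>2 = ((1 + r\<^sup>2)\<^sup>2 - (1 - r\<^sup>2)\<^sup>2) / (1 + r\<^sup>2)\<^sup>2"
      by (simp add: diff_divide_distrib)
    also have "(1 + r\<^sup>2)\<^sup>2 - (1 - r\<^sup>2)\<^sup>2 = (2 * r)\<^sup>2" by (simp add: power2_eq_square algebra_simps)
    finally show ?thesis by (simp add: power_divide)
  qed
  finally show ?thesis
    by (rule power2_le_imp_le) (use assms in auto)
qed

text \<open>Brouwer's theorem gives a fixed point \<open>p\<close>.  Conjugation with the automorphism that exchanges \<open>p\<close> and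
  \<open>0\<close> turns \<open>f\<close> into a map that fixes \<open>0\<close> and has values in a disc of radius \<open>k < 1\<close>, so Schwarz's
  lemma makes \<open>f\<close> a contraction with factor \<open>k\<close> for the pseudo-hyperbolic distance to \<open>p\<close>.  The rate
  depends on \<open>r\<close> alone; this uniformity is what makes the limit holomorphic in a parameter of \<open>f\<close>.\<close>
lemma iterates_unit_disc_converge:
  fixes f :: "complex \<Rightarrow> complex"
  assumes hol: "f holomorphic_on ball 0 1" and sub: "f ` ball 0 1 \<subseteq> cball 0 r"
    and r: "0 < r" "r < 1"
  obtains p where "p \<in> cball 0 r" "f p = p"
    "\<And>n x. norm x < 1 \<Longrightarrow> norm ((f ^^ n) x - p) \<le> 2 * (2 * r / (1 + r\<^sup>2)) ^ n"
proof -
  define k where "k = 2 * r / (1 + r\<^sup>2)"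
  have sub': "cball (0::complex) r \<subseteq> ball 0 1" using r by auto
  have "continuous_on (cball 0 r) f"
    using holomorphic_on_imp_continuous_on[OF hol] continuous_on_subset sub' by blast
  moreover have "f ` cball 0 r \<subseteq> cball 0 r" using sub sub' by blast
  ultimately obtain p where p: "p \<in> cball 0 r" "f p = p"
    using brouwer_ball[of r 0 f] r by (auto simp: Pi_iff image_subset_iff)
  have p1: "norm p < 1" using p r by auto
  have k: "0 < k" "k < 1"
  proof -
    have "0 < (1 - r)\<^sup>2" using r by simp
    then have "2 * r < 1 + r\<^sup>2" by (simp add: power2_eq_square algebra_simps)
    then show "k < 1" "0 < k" using r by (auto simp: k_def field_simps add_pos_nonneg)
  qed
  define \<phi> where "\<phi> = Moebius_function 0 p"
  define \<psi> where "\<psi> = Moebius_function 0 (-p)"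
  have \<psi>b: "norm (\<psi> x) < 1" if "norm x < 1" for x
    using that p1 Moebius_function_norm_lt_1 by (simp add: \<psi>_def)
  have \<phi>b: "norm (\<phi> x) < 1" if "norm x < 1" for x
    using that p1 Moebius_function_norm_lt_1 by (simp add: \<phi>_def)
  have inv1: "\<psi> (\<phi> x) = x" if "norm x < 1" for x
    unfolding \<phi>_def \<psi>_def using that p1 by (intro Moebius_function_compose) auto
  have fb: "norm (f x) \<le> r" if "norm x < 1" for x using sub that by (auto simp: image_subset_iff)
  define g where "g x = \<phi> (f (\<psi> x)) / k" for x
  have "g holomorphic_on ball 0 1"
  proof -
    have hol\<psi>: "\<psi> holomorphic_on ball 0 1" and hol\<phi>: "\<phi> holomorphic_on ball 0 1"
      using p1 by (auto simp: \<phi>_def \<psi>_def intro!: Moebius_function_holomorphic)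
    have "f \<circ> \<psi> holomorphic_on ball 0 1"
      using hol\<psi> hol by (rule holomorphic_on_compose_gen) (use \<psi>b in auto)
    then have "\<phi> \<circ> (f \<circ> \<psi>) holomorphic_on ball 0 1"
    proof (rule holomorphic_on_compose_gen[OF _ hol\<phi>])
      have "norm (f (\<psi> x)) < 1" if "norm x < 1" for x
        using fb[OF \<psi>b[OF that]] r by linarith
      then show "(f \<circ> \<psi>) ` ball 0 1 \<subseteq> ball 0 1" by auto
    qed
    then have "(\<lambda>x. (\<phi> \<circ> (f \<circ> \<psi>)) x / of_real k) holomorphic_on ball 0 1"
      using k by (auto intro!: holomorphic_intros simp: o_def)
    then show ?thesis by (simp add: g_def[abs_def] o_def)
  qed
  moreover have "g 0 = 0"
    using p(2) by (simp add: g_def \<psi>_def \<phi>_def Moebius_function_simple)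
  moreover have gb: "norm (g x) \<le> 1" if "norm x < 1" for x
  proof -
    have "norm (\<phi> (f (\<psi> x))) \<le> k"
      unfolding \<phi>_def k_def using p r fb[OF \<psi>b[OF that]] by (intro Moebius_bound) auto
    then show ?thesis using k by (simp add: g_def norm_divide)
  qed
  ultimately have gS: "norm (g x) \<le> norm x" if "norm x < 1" for x
  proof -
    \<comment> \<open>\<open>g\<close> takes values in the closed disc, Schwarz's lemma wants the open one: scale by \<open>s < 1\<close>\<close>
    have gt: "norm (g x) * s \<le> norm x" if s: "0 < s" "s < 1" for s :: real
    proof -
      have "norm (s * g x) \<le> norm x"
      proof (rule Schwarz_Lemma(1)[where f = "\<lambda>x. s * g x"])
        show "(\<lambda>x. complex_of_real s * g x) holomorphic_on ball 0 1"
          using \<open>g holomorphic_on ball 0 1\<close> by (intro holomorphic_intros)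
        show "norm (of_real s * g z) < 1" if "norm z < 1" for z
          using gb[OF that] s by (simp add: norm_mult) (smt (verit) mult_left_le norm_ge_zero)
      qed (use \<open>g 0 = 0\<close> \<open>norm x < 1\<close> in auto)
      then show ?thesis using s by (simp add: norm_mult mult.commute)
    qed
    show ?thesis
    proof (rule ccontr)
      assume "\<not> ?thesis"
      then obtain s where s: "norm x < s" "s < norm (g x)"
        using dense[of "norm x" "norm (g x)"] by auto
      have "0 < s" using s(1) norm_ge_zero[of x] by linarith
      then have gx: "0 < norm (g x)" using s by linarith
      have "norm (g x) * (s / norm (g x)) \<le> norm x"
        using s gx \<open>0 < s\<close> by (intro gt) (auto simp only: divide_pos_pos divide_less_eq_1_pos)
      moreover have "norm (g x) * (s / norm (g x)) = s" using s \<open>0 < s\<close> by auto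
      ultimately show False using s by linarith
    qed
  qed
  have step: "norm (\<phi> (f x)) \<le> k * norm (\<phi> x)" if "norm x < 1" for x
    using gS[OF \<phi>b[OF that]] k by (simp add: g_def inv1[OF that] norm_divide field_simps)
  have it: "norm ((f ^^ n) x) < 1 \<and> norm (\<phi> ((f ^^ n) x)) \<le> k ^ n" if "norm x < 1" for n x
  proof (induction n)
    case 0 then show ?case using that \<phi>b[OF that] by simp
  next
    case (Suc n)
    then have "norm (\<phi> ((f ^^ Suc n) x)) \<le> k * norm (\<phi> ((f ^^ n) x))" using step by simp
    also have "\<dots> \<le> k * k ^ n" using Suc k by (intro mult_left_mono) auto
    finally show ?case using fb[of "(f ^^ n) x"] Suc r by simp
  qed
  \<comment> \<open>the pseudo-hyperbolic distance controls the Euclidean one\<close>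
  have "norm (x - p) \<le> 2 * norm (\<phi> x)" if "norm x < 1" for x
  proof -
    have lt: "norm (cnj p * x) < 1" using p1 that norm_mult_less[of "cnj p" 1 x 1] by simp
    then have "1 - cnj p * x \<noteq> 0" by auto
    then have "x - p = \<phi> x * (1 - cnj p * x)" by (simp add: \<phi>_def Moebius_function_simple)
    moreover have "norm (1 - cnj p * x) \<le> 2"
      using norm_triangle_ineq4[of 1 "cnj p * x"] lt by simp
    ultimately show ?thesis by (metis mult.commute mult_left_mono norm_ge_zero norm_mult)
  qed
  with it have "norm ((f ^^ n) x - p) \<le> 2 * k ^ n" if "norm x < 1" for n x
    using that by (smt (verit))
  then show ?thesis using that p unfolding k_def by blast
qed

lemma iterates_disc_converge:
  fixes f :: "complex \<Rightarrow> complex"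
  assumes hol: "f holomorphic_on ball a R" and sub: "f ` ball a R \<subseteq> cball a (r * R)"
    and r: "0 < r" "r < 1" and R: "0 < R"
  obtains p where "p \<in> cball a (r * R)" "f p = p"
    "\<And>n x. x \<in> ball a R \<Longrightarrow> norm ((f ^^ n) x - p) \<le> 2 * R * (2 * r / (1 + r\<^sup>2)) ^ n"
proof -
  define h where "h x = a + of_real R * x" for x
  define F where "F x = (f (h x) - a) / of_real R" for x
  have hb: "h x \<in> ball a R" if "norm x < 1" for x
    using that R by (simp add: h_def dist_norm norm_mult)
  have hF: "h (F x) = f (h x)" for x using R by (simp add: h_def F_def)
  have hFn: "h ((F ^^ n) x) = (f ^^ n) (h x)" for n x
    by (induction n) (auto simp: hF)
  have "(\<lambda>x. ((f \<circ> h) x - a) / of_real R) holomorphic_on ball 0 1"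
    using hb R by (intro holomorphic_intros holomorphic_on_compose_gen[OF _ hol])
      (auto simp: h_def[abs_def] intro!: holomorphic_intros)
  then have "F holomorphic_on ball 0 1" by (simp add: F_def[abs_def] o_def)
  moreover have "F ` ball 0 1 \<subseteq> cball 0 r"
  proof (clarsimp simp: F_def norm_divide)
    fix x :: complex assume "norm x < 1"
    then have "f (h x) \<in> cball a (r * R)" using sub hb by blast
    then show "norm (f (h x) - a) / \<bar>R\<bar> \<le> r" using R by (simp add: dist_norm norm_minus_commute field_simps)
  qed
  ultimately obtain p where p: "p \<in> cball 0 r" "F p = p"
    "\<And>n x. norm x < 1 \<Longrightarrow> norm ((F ^^ n) x - p) \<le> 2 * (2 * r / (1 + r\<^sup>2)) ^ n"
    using iterates_unit_disc_converge r by metis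
  show ?thesis
  proof
    show "h p \<in> cball a (r * R)" using p(1) R by (simp add: h_def norm_mult dist_norm mult.commute)
    show "f (h p) = h p" using hF[of p] p(2) by simp
    fix n x assume x: "x \<in> ball a R"
    define y where "y = (x - a) / of_real R"
    have xy: "x = h y" using R by (simp add: y_def h_def)
    have "norm y < 1" using x R by (simp add: y_def norm_divide dist_norm norm_minus_commute)
    note B = p(3)[OF this, of n]
    have "(f ^^ n) x - h p = of_real R * ((F ^^ n) y - p)"
      unfolding xy hFn[symmetric] by (simp add: h_def algebra_simps)
    then show "norm ((f ^^ n) x - h p) \<le> 2 * R * (2 * r / (1 + r\<^sup>2)) ^ n"
      using B R by (simp add: norm_mult mult.assoc)
  qed
qed

section \<open>Cauchy transforms and their centred reciprocals\<close>

lemma cauchy_schwarz_integral: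
  fixes f g :: "'a \<Rightarrow> real"
  assumes [measurable]: "f \<in> borel_measurable M" "g \<in> borel_measurable M"
    and f: "integrable M (\<lambda>x. (f x)\<^sup>2)" and g: "integrable M (\<lambda>x. (g x)\<^sup>2)"
  shows "integrable M (\<lambda>x. f x * g x)"
    and "(\<integral>x. f x * g x \<partial>M)\<^sup>2 \<le> (\<integral>x. (f x)\<^sup>2 \<partial>M) * (\<integral>x. (g x)\<^sup>2 \<partial>M)"
proof -
  show fg: "integrable M (\<lambda>x. f x * g x)"
  proof (rule Bochner_Integration.integrable_bound[where f = "\<lambda>x. (f x)\<^sup>2 + (g x)\<^sup>2"])
    have "\<bar>a * b\<bar> \<le> \<bar>a\<^sup>2 + b\<^sup>2\<bar>" for a b :: real
    proof -
      have "0 \<le> (\<bar>a\<bar> - \<bar>b\<bar>)\<^sup>2" "0 \<le> a\<^sup>2 + b\<^sup>2" "0 \<le> \<bar>a\<bar> * \<bar>b\<bar>" by auto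
      then show ?thesis unfolding power2_diff abs_mult by (simp only: power2_abs)
    qed
    then show "AE x in M. norm (f x * g x) \<le> norm ((f x)\<^sup>2 + (g x)\<^sup>2)" by simp
  qed (use f g in auto)
  define a A B where "a = (\<integral>x. f x * g x \<partial>M)" and "A = (\<integral>x. (f x)\<^sup>2 \<partial>M)"
    and "B = (\<integral>x. (g x)\<^sup>2 \<partial>M)"
  have A0: "0 \<le> A" by (simp add: A_def)
  \<comment> \<open>the \<open>e\<close> avoids a separate treatment of \<open>A = 0\<close>\<close>
  have "a\<^sup>2 \<le> (A + e) * B" if e: "0 < e" for e
  proof -
    have exp: "((A + e) * g x - a * f x)\<^sup>2
        = (A + e)\<^sup>2 * (g x)\<^sup>2 - 2 * (A + e) * a * (f x * g x) + a\<^sup>2 * (f x)\<^sup>2" for x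
      by (simp add: power2_eq_square algebra_simps)
    have "0 \<le> (\<integral>x. ((A + e) * g x - a * f x)\<^sup>2 \<partial>M)" by simp
    also have "\<dots> = (A + e)\<^sup>2 * B - 2 * (A + e) * a * a + a\<^sup>2 * A"
      unfolding exp using f g fg by (simp add: A_def[symmetric] B_def[symmetric] a_def[symmetric])
    also have "\<dots> \<le> (A + e)\<^sup>2 * B - 2 * (A + e) * a * a + a\<^sup>2 * (A + e)"
      using e by (intro add_left_mono mult_left_mono) auto
    also have "\<dots> = (A + e) * ((A + e) * B - a\<^sup>2)" by (simp add: power2_eq_square algebra_simps)
    finally show ?thesis using A0 e by (simp add: zero_le_mult_iff)
  qed
  then have "\<forall>e>0. a\<^sup>2 \<le> A * B + e * B" by (simp add: distrib_right)
  have "((\<lambda>e. A * B + e * B) \<longlongrightarrow> A * B + 0 * B) (at_right 0)"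
    by (intro tendsto_intros)
  then have "a\<^sup>2 \<le> A * B + 0 * B"
    by (rule tendsto_lowerbound)
       (use \<open>\<forall>e>0. a\<^sup>2 \<le> A * B + e * B\<close> in \<open>auto simp: eventually_at_right_less eventually_at_filter\<close>)
  then show "(\<integral>x. f x * g x \<partial>M)\<^sup>2 \<le> (\<integral>x. (f x)\<^sup>2 \<partial>M) * (\<integral>x. (g x)\<^sup>2 \<partial>M)"
    by (simp add: a_def A_def B_def)
qed

context real_distribution
begin

lemma prob_UNIV: "prob UNIV = 1"
  using prob_space by simp

lemma integrable_resolvent:
  assumes "0 < d" "AE t in M. d \<le> cmod (z - of_real t)"
  shows "integrable M (\<lambda>t. 1 / (z - complex_of_real t))"
proof (rule integrable_const_bound[where B = "1 / d"])
  show "AE t in M. norm (1 / (z - complex_of_real t)) \<le> 1 / d"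
    using assms(2)
  proof eventually_elim
    case (elim t)
    then show ?case using \<open>0 < d\<close> by (simp add: norm_divide frac_le)
  qed
qed measurable

lemma norm_G_transform_le:
  assumes "0 < d" "AE t in M. d \<le> cmod (z - of_real t)"
  shows "cmod (G_transform M z) \<le> 1 / d"
proof -
  have "cmod (G_transform M z) \<le> (\<integral>t. cmod (1 / (z - complex_of_real t)) \<partial>M)"
    unfolding G_transform_def by (rule integral_norm_bound)
  also have "\<dots> \<le> (\<integral>t. 1 / d \<partial>M)"
  proof (rule integral_mono_AE)
    show "AE t in M. cmod (1 / (z - complex_of_real t)) \<le> 1 / d"
      using assms(2)
    proof eventually_elim
      case (elim t)
      then show ?case using \<open>0 < d\<close> by (simp add: norm_divide frac_le)
    qed
    show "integrable M (\<lambda>t. cmod (1 / (z - complex_of_real t)))"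
      using integrable_resolvent[OF assms] by (rule integrable_norm)
  qed simp
  finally show ?thesis by (simp add: prob_UNIV)
qed

text \<open>Differentiation under the integral sign: the second-order remainder
  \<open>h / ((z + h - t) (z - t)\<^sup>2)\<close> of the resolvent is \<open>O(h)\<close> uniformly in \<open>t\<close>, because \<open>z\<close> keeps a positive distance
  from the support.\<close>
lemma G_transform_has_field_derivative:
  assumes d: "0 < d" "AE t in M. d \<le> cmod (z - of_real t)"
  shows "(G_transform M has_field_derivative - (\<integral>t. 1 / (z - complex_of_real t)\<^sup>2 \<partial>M)) (at z)"
  unfolding has_field_derivative_iff
proof -
  define k where "k w t = 1 / (w - complex_of_real t)" for w t
  define L where "L = (\<integral>t. (k z t)\<^sup>2 \<partial>M)"
  have km[measurable]: "k w \<in> borel_measurable M" for w unfolding k_def by measurable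
  have kz: "AE t in M. cmod (k z t) \<le> 1 / d"
    using d(2)
  proof eventually_elim
    case (elim t)
    then show ?case using \<open>0 < d\<close> by (simp add: norm_divide frac_le k_def)
  qed
  have bound: "cmod ((G_transform M (z + h) - G_transform M z) / h + L) \<le> (2 / d ^ 3) * cmod h"
    if h: "h \<noteq> 0" "cmod h < d / 2" for h
  proof -
    have far: "AE t in M. d / 2 \<le> cmod (z + h - of_real t)"
      using d(2)
    proof eventually_elim
      case (elim t)
      then show ?case using h norm_diff_ineq[of "z - of_real t" h] by (simp add: algebra_simps)
    qed
    have kh: "AE t in M. cmod (k (z + h) t) \<le> 2 / d"
      using far
    proof eventually_elim
      case (elim t)
      then show ?case using \<open>0 < d\<close> frac_le[of 1 1 "d/2"] by (simp add: norm_divide k_def)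
    qed
    have i1: "integrable M (k z)" "integrable M (k (z + h))"
      using integrable_resolvent[OF d] integrable_resolvent[OF _ far] \<open>0 < d\<close> by (auto simp: k_def[abs_def])
    have i2: "integrable M (\<lambda>t. (k z t)\<^sup>2)"
    proof (rule integrable_const_bound[where B = "(1 / d)\<^sup>2"])
      show "AE t in M. norm ((k z t)\<^sup>2) \<le> (1 / d)\<^sup>2"
        using kz
      proof eventually_elim
        case (elim t)
        then show ?case unfolding norm_power by (intro power_mono) auto
      qed
    qed measurable
    have "(G_transform M (z + h) - G_transform M z) / h + L
        = (\<integral>t. (k (z + h) t - k z t) / h + (k z t)\<^sup>2 \<partial>M)"
      using i1 i2 by (simp add: G_transform_def L_def k_def[abs_def])
    also have "cmod \<dots> \<le> (\<integral>t. cmod ((k (z + h) t - k z t) / h + (k z t)\<^sup>2) \<partial>M)"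
      by (rule integral_norm_bound)
    also have "\<dots> \<le> (\<integral>t. (2 / d ^ 3) * cmod h \<partial>M)"
    proof (rule integral_mono_AE)
      show "integrable M (\<lambda>t. cmod ((k (z + h) t - k z t) / h + (k z t)\<^sup>2))"
        using i1 i2 by simp
      show "AE t in M. cmod ((k (z + h) t - k z t) / h + (k z t)\<^sup>2) \<le> (2 / d ^ 3) * cmod h"
        using kz kh d(2) far
      proof eventually_elim
        case (elim t)
        then have "z - of_real t \<noteq> 0" "z + h - of_real t \<noteq> 0" using \<open>0 < d\<close> by auto
        then have "(k (z + h) t - k z t) / h + (k z t)\<^sup>2 = h * k (z + h) t * (k z t)\<^sup>2"
        proof -
          have "(1 / (A + h) - 1 / A) / h + (1 / A)\<^sup>2 = h * (1 / (A + h)) * (1 / A)\<^sup>2"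
            if "A \<noteq> 0" "A + h \<noteq> 0" for A
            using that h(1) by (simp add: divide_simps power2_eq_square)
          from this[of "z - of_real t"] \<open>z - of_real t \<noteq> 0\<close> \<open>z + h - of_real t \<noteq> 0\<close>
          show ?thesis by (simp add: k_def algebra_simps)
        qed
        then have "cmod ((k (z + h) t - k z t) / h + (k z t)\<^sup>2)
            = cmod h * (cmod (k (z + h) t) * (cmod (k z t))\<^sup>2)"
          by (simp add: norm_mult norm_power)
        also have "\<dots> \<le> cmod h * ((2 / d) * (1 / d)\<^sup>2)"
          using elim \<open>0 < d\<close> by (intro mult_left_mono mult_mono power_mono) auto
        finally show ?case by (simp add: power2_eq_square power3_eq_cube mult_ac)
      qed
    qed simp
    finally show ?thesis by (simp add: prob_UNIV)
  qed
  have "((\<lambda>h. (G_transform M (z + h) - G_transform M z) / h + L) \<longlongrightarrow> 0) (at 0)"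
  proof (rule tendsto_0_le[where f = "\<lambda>h. h" and K = "2 / d ^ 3"])
    show "\<forall>\<^sub>F h in at 0. norm ((G_transform M (z + h) - G_transform M z) / h + L) \<le> norm h * (2 / d ^ 3)"
      unfolding eventually_at using bound \<open>0 < d\<close>
      by (intro exI[of _ "d / 2"]) (auto simp: mult.commute)
  qed (rule tendsto_ident_at)
  then have "((\<lambda>h. (G_transform M (z + h) - G_transform M z) / h) \<longlongrightarrow> - L) (at 0)"
    using tendsto_diff[OF _ tendsto_const, of _ 0 "at 0" L] by fastforce
  then show "((\<lambda>w. (G_transform M w - G_transform M z) / (w - z))
      \<longlongrightarrow> - (\<integral>t. 1 / (z - complex_of_real t)\<^sup>2 \<partial>M)) (at z)"
    by (subst LIM_offset_zero_iff) (simp_all add: L_def k_def power_one_over)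
qed

lemma G_transform_cnj: "G_transform M (cnj z) = cnj (G_transform M z)"
proof -
  have "cnj (G_transform M z) = (\<integral>t. cnj (1 / (z - complex_of_real t)) \<partial>M)"
    unfolding G_transform_def by (rule Bochner_Integration.integral_cnj[symmetric])
  then show ?thesis by (simp add: G_transform_def)
qed

text \<open>If some line through \<open>0\<close> has all the vectors \<open>z - t\<close> strictly on one side, then the values of the
  resolvent lie in an open half-plane as well, and their average cannot vanish.\<close>
lemma G_transform_nonzero:
  assumes d: "0 < d" "AE t in M. d \<le> cmod (z - of_real t)"
    and e: "AE t in M. 0 < Re (e * cnj (z - of_real t))"
  shows "G_transform M z \<noteq> 0"
proof
  assume 0: "G_transform M z = 0"
  note i = integrable_resolvent[OF d]
  have "(\<integral>t. (0::real) \<partial>M) < (\<integral>t. Re (e * (1 / (z - of_real t))) \<partial>M)"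
  proof (rule integral_less_AE_space)
    show "integrable M (\<lambda>t. Re (e * (1 / (z - complex_of_real t))))"
      using i by (intro integrable_Re integrable_mult_right)
    show "AE t in M. 0 < Re (e * (1 / (z - complex_of_real t)))"
      using e d(2)
    proof eventually_elim
      case (elim t)
      then have nz: "z - of_real t \<noteq> 0" using \<open>0 < d\<close> by auto
      have "1 / (z - of_real t) = cnj (z - of_real t) / of_real ((cmod (z - of_real t))\<^sup>2)"
        unfolding complex_norm_square using nz by (simp del: complex_cnj_diff)
      then have "Re (e * (1 / (z - of_real t))) = Re (e * cnj (z - of_real t)) / (cmod (z - of_real t))\<^sup>2"
        by (simp only: times_divide_eq_right Re_divide_of_real)
      then show ?case using elim nz by simp
    qed
  qed (use emeasure_space_1 in auto)
  also have "\<dots> = Re (e * G_transform M z)"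
  proof -
    have "(\<integral>t. Re (e * (1 / (z - of_real t))) \<partial>M) = Re (\<integral>t. e * (1 / (z - of_real t)) \<partial>M)"
      using i by (intro integral_Re integrable_mult_right)
    also have "(\<integral>t. e * (1 / (z - of_real t)) \<partial>M) = e * G_transform M z"
      unfolding G_transform_def by (rule integral_mult_right_zero)
    finally show ?thesis .
  qed
  finally show False using 0 by simp
qed

end

text \<open>For a measure with variance \<open>\<sigma>\<^sup>2 > 0\<close> this is \<open>\<sigma>\<^sup>2 G\<^sub>\<nu>\<close> for a probability measure \<open>\<nu>\<close>, the first
  step of the continued fraction.  The existence of \<open>\<nu>\<close> is replaced below by inequalities that
  express what it entails.\<close>
definition h_centred :: "real measure \<Rightarrow> complex \<Rightarrow> complex" where
  "h_centred \<mu> u = u - mean \<mu> - F_transform \<mu> u"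

context real_distribution
begin

lemma integrable_of_square:
  assumes "integrable M (\<lambda>x. x\<^sup>2)"
  shows "integrable M (\<lambda>x. x)"
  using square_integrable_imp_integrable[of "\<lambda>x. x"] assms by simp

text \<open>Put \<open>g t = F / (u - t) - 1\<close>, where \<open>F = 1 / G\<close>.  It has integral \<open>0\<close> and solves \<open>(u - t) g = (t - mean) - W\<close> with
  \<open>W = h_centred M u\<close>: up to the constant \<open>W\<close>, it is the resolvent of the multiplication
  operator compressed to the functions of integral \<open>0\<close>, applied to \<open>t - mean\<close>.  Pairing this equation with \<open>g\<close>
  gives \<open>W = u\<^sup>* N - m\<close> with \<open>N = \<integral>\<bar>g\<bar>\<^sup>2\<close> and \<open>m = \<integral>t \<bar>g\<bar>\<^sup>2\<close>, and since \<open>W = \<integral>(t - mean) g\<close>, Cauchy-Schwarz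
  bounds \<open>W\<close>.  Here \<open>u\<^sup>*\<close> is the complex conjugate.\<close>
lemma h_centred_resolvent:
  assumes d: "0 < d" "AE t in M. d \<le> cmod (u - of_real t)"
    and sq: "integrable M (\<lambda>x. x\<^sup>2)" and G0: "G_transform M u \<noteq> 0"
  shows "\<exists>N m :: real. 0 \<le> N \<and> h_centred M u = cnj u * of_real N - of_real m
    \<and> (cmod (h_centred M u))\<^sup>2 \<le> var M * N \<and> ((AE t in M. 0 \<le> t) \<longrightarrow> 0 \<le> m)"
proof -
  define k where "k t = 1 / (u - complex_of_real t)" for t
  define F where "F = F_transform M u"
  define W where "W = h_centred M u"
  define g where "g t = F * k t - 1" for t
  define C where "C = cmod F / d + 1"
  have W: "W = u - mean M - F" by (simp add: W_def h_centred_def F_def)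
  have km[measurable]: "k \<in> borel_measurable M" unfolding k_def by measurable
  have gm[measurable]: "g \<in> borel_measurable M" unfolding g_def by measurable
  have C: "0 \<le> C" using d by (simp add: C_def)
  have ik: "integrable M k" using integrable_resolvent[OF d] by (simp add: k_def[abs_def])
  have gb: "AE t in M. cmod (g t) \<le> C"
    using d(2)
  proof eventually_elim
    case (elim t)
    have "cmod (k t) \<le> 1 / d" using elim d by (simp add: k_def norm_divide frac_le)
    then have "cmod (F * k t) \<le> cmod F * (1 / d)"
      unfolding norm_mult by (rule mult_left_mono) simp
    then show ?case using norm_triangle_ineq4[of "F * k t" 1] by (simp add: g_def C_def)
  qed
  have g2b: "AE t in M. (cmod (g t))\<^sup>2 \<le> C\<^sup>2"
    using gb by eventually_elim (simp add: power_mono)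
  have ix: "integrable M (\<lambda>t. t)" using sq by (rule integrable_of_square)
  have ixm: "integrable M (\<lambda>t. t - mean M)" using ix by simp
  have ig: "integrable M g" unfolding g_def using ik by simp
  have ig0: "(\<integral>t. g t \<partial>M) = 0"
  proof -
    have "G_transform M u = (\<integral>t. k t \<partial>M)" by (simp add: G_transform_def k_def)
    then have "(\<integral>t. g t \<partial>M) = F * G_transform M u - of_real (prob UNIV)"
      unfolding g_def using ik by (simp add: scaleR_conv_of_real)
    then show ?thesis using G0 by (simp add: F_def F_transform_def prob_UNIV)
  qed
  have ig2: "integrable M (\<lambda>t. (cmod (g t))\<^sup>2)"
    by (rule integrable_const_bound[where B = "C\<^sup>2"]) (use g2b in auto)
  have itg2: "integrable M (\<lambda>t. t * (cmod (g t))\<^sup>2)"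
  proof (rule Bochner_Integration.integrable_bound[where f = "\<lambda>t. t * C\<^sup>2"])
    show "AE t in M. norm (t * (cmod (g t))\<^sup>2) \<le> norm (t * C\<^sup>2)"
      using g2b by eventually_elim (simp add: abs_mult mult_left_mono)
    show "integrable M (\<lambda>t. t * C\<^sup>2)" using ix by (rule integrable_mult_left)
  qed measurable
  have ixg: "integrable M (\<lambda>t. of_real (t - mean M) * g t)"
  proof (rule Bochner_Integration.integrable_bound[where f = "\<lambda>t. (t - mean M) * C"])
    show "AE t in M. norm (of_real (t - mean M) * g t) \<le> norm ((t - mean M) * C)"
      using gb
    proof eventually_elim
      case (elim t)
      have "norm (of_real (t - mean M) * g t) = \<bar>t - mean M\<bar> * cmod (g t)"
        by (simp only: norm_mult norm_of_real)
      then show ?case using elim C by (simp add: abs_mult mult_left_mono)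
    qed
    show "integrable M (\<lambda>t. (t - mean M) * C)" using ixm by (rule integrable_mult_left)
  qed measurable
  define N where "N = (\<integral>t. (cmod (g t))\<^sup>2 \<partial>M)"
  define m where "m = (\<integral>t. t * (cmod (g t))\<^sup>2 \<partial>M)"
  have pointwise: "AE t in M. of_real (t - mean M) * g t = (u - mean M) * g t + (u - of_real t) - F"
    using d(2)
  proof eventually_elim
    case (elim t)
    then have "u - of_real t \<noteq> 0" using d(1) by auto
    then have "(u - of_real t) * g t = F - (u - of_real t)"
      by (simp add: g_def k_def field_simps)
    moreover have "of_real (t - mean M) * g t = (u - mean M) * g t - (u - of_real t) * g t"
      by (simp add: algebra_simps)
    ultimately show ?case by simp
  qed
  have Wint: "W = (\<integral>t. of_real (t - mean M) * g t \<partial>M)"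
  proof -
    have "(\<integral>t. of_real (t - mean M) * g t \<partial>M)
        = (\<integral>t. (u - mean M) * g t + (u - of_real t) - F \<partial>M)"
      using pointwise by (intro integral_cong_AE) auto
    also have "\<dots> = (u - mean M) * (\<integral>t. g t \<partial>M) + (u - of_real (\<integral>t. t \<partial>M)) - F"
      using ig ix by (simp add: prob_UNIV)
    finally show ?thesis by (simp add: ig0 W mean_def)
  qed
  have "W = cnj u * of_real N - of_real m"
  proof -
    have pw2: "AE t in M. cnj (u - of_real t) * of_real ((cmod (g t))\<^sup>2)
        = of_real (t - mean M) * g t - cnj W * g t"
      using d(2)
    proof eventually_elim
      case (elim t)
      then have "u - of_real t \<noteq> 0" using d(1) by auto
      then have "(u - of_real t) * g t = of_real (t - mean M) - W"
        by (simp add: g_def k_def W field_simps)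
      then have "cnj (u - of_real t) * cnj (g t) = of_real (t - mean M) - cnj W"
        by (metis complex_cnj_complex_of_real complex_cnj_diff complex_cnj_mult)
      then have "cnj (u - of_real t) * cnj (g t) * g t = (of_real (t - mean M) - cnj W) * g t"
        by simp
      then show ?case
        unfolding complex_norm_square by (simp only: mult.assoc mult.commute[of "g t"] left_diff_distrib)
    qed
    have "cnj u * of_real N - of_real m
        = (\<integral>t. cnj u * of_real ((cmod (g t))\<^sup>2) - of_real (t * (cmod (g t))\<^sup>2) \<partial>M)"
      using ig2 itg2 by (simp add: N_def m_def del: of_real_mult of_real_power)
    also have "\<dots> = (\<integral>t. of_real (t - mean M) * g t - cnj W * g t \<partial>M)"
      using pw2 by (intro integral_cong_AE) (auto simp: algebra_simps)
    also have "\<dots> = W - cnj W * 0"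
      unfolding Wint ig0[symmetric] using ixg ig by simp
    finally show ?thesis by simp
  qed
  moreover have "(cmod W)\<^sup>2 \<le> var M * N"
  proof -
    have iv: "integrable M (\<lambda>t. (\<bar>t - mean M\<bar>)\<^sup>2)"
      using sq ix by (simp add: power2_diff)
    have "cmod W \<le> (\<integral>t. \<bar>t - mean M\<bar> * cmod (g t) \<partial>M)"
      unfolding Wint using integral_norm_bound[of M "\<lambda>t. of_real (t - mean M) * g t"]
      by (simp only: norm_mult norm_of_real)
    then have "(cmod W)\<^sup>2 \<le> (\<integral>t. \<bar>t - mean M\<bar> * cmod (g t) \<partial>M)\<^sup>2"
      by (intro power_mono) auto
    also have "\<dots> \<le> (\<integral>t. (\<bar>t - mean M\<bar>)\<^sup>2 \<partial>M) * (\<integral>t. (cmod (g t))\<^sup>2 \<partial>M)"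
      using iv ig2 by (intro cauchy_schwarz_integral) auto
    finally show ?thesis by (simp add: var_def N_def)
  qed
  moreover have "(AE t in M. 0 \<le> t) \<longrightarrow> 0 \<le> m"
    unfolding m_def by (intro impI integral_nonneg_AE) auto
  moreover have "0 \<le> N" by (simp add: N_def)
  ultimately show ?thesis unfolding W_def by (intro exI[of _ N] exI[of _ m] conjI)
qed

lemma G_transform_nonzero_upper: "Im u \<noteq> 0 \<Longrightarrow> G_transform M u \<noteq> 0"
proof (rule G_transform_nonzero[where d = "\<bar>Im u\<bar>" and e = "\<i> * sgn (Im u)"])
  assume "Im u \<noteq> 0"
  have "\<bar>Im u\<bar> \<le> cmod (u - of_real t)" for t using abs_Im_le_cmod[of "u - of_real t"] by simp
  then show "AE t in M. \<bar>Im u\<bar> \<le> cmod (u - of_real t)" by simp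
  show "AE t in M. 0 < Re (\<i> * complex_of_real (sgn (Im u)) * cnj (u - complex_of_real t))"
    using \<open>Im u \<noteq> 0\<close> by (simp add: sgn_if)
qed auto

lemma h_centred_cnj: "h_centred M (cnj u) = cnj (h_centred M u)"
  by (simp add: h_centred_def F_transform_def G_transform_cnj)

end

lemma dist_nonneg_reals:
  assumes "u \<notin> \<real>\<^sub>\<ge>\<^sub>0"
  shows "\<exists>d>0. \<forall>t\<ge>0. d \<le> cmod (u - of_real t)"
proof (intro exI conjI allI impI)
  have "closed (\<real>\<^sub>\<ge>\<^sub>0 :: complex set)" by (rule closed_nonneg_Reals_complex)
  then have "infdist u (\<real>\<^sub>\<ge>\<^sub>0) \<noteq> 0"
    using assms in_closed_iff_infdist_zero[of "\<real>\<^sub>\<ge>\<^sub>0" u] nonneg_Reals_zero_I by blast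
  then show "0 < infdist u (\<real>\<^sub>\<ge>\<^sub>0)"
    using infdist_nonneg[of u "\<real>\<^sub>\<ge>\<^sub>0"] by linarith
  show "infdist u (\<real>\<^sub>\<ge>\<^sub>0) \<le> cmod (u - of_real t)" if "0 \<le> t" for t
    using infdist_le[of "of_real t" "\<real>\<^sub>\<ge>\<^sub>0" u] that by (simp add: dist_norm)
qed

context real_distribution
begin

lemma G_transform_nonzero_slit:
  assumes pos: "AE t in M. 0 \<le> t" and u: "u \<notin> \<real>\<^sub>\<ge>\<^sub>0"
  shows "G_transform M u \<noteq> 0"
proof (cases "Im u = 0")
  case False then show ?thesis by (rule G_transform_nonzero_upper)
next
  case True
  then have neg: "Re u < 0" using u by (auto simp: complex_nonneg_Reals_iff)
  obtain d where d: "0 < d" "\<forall>t\<ge>0. d \<le> cmod (u - of_real t)"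
    using dist_nonneg_reals[OF u] by blast
  show ?thesis
  proof (rule G_transform_nonzero[OF d(1), where e = "-1"])
    show "AE t in M. d \<le> cmod (u - of_real t)" using pos by eventually_elim (use d in auto)
    show "AE t in M. 0 < Re (- 1 * cnj (u - complex_of_real t))"
      using pos by eventually_elim (use neg in auto)
  qed
qed

text \<open>The imaginary part of \<open>u\<^sup>* N - m\<close> is \<open>- N Im u\<close>, so the bound of \<open>\<bar>W\<bar>\<^sup>2\<close> by a multiple of \<open>N\<close> confines \<open>W\<close> to
  a disc in the closed lower half-plane that touches the real line at \<open>0\<close>.\<close>
lemma h_centred_upper:
  assumes sq: "integrable M (\<lambda>x. x\<^sup>2)" and u: "0 < Im u"
  shows "Im u * (cmod (h_centred M u))\<^sup>2 \<le> var M * - Im (h_centred M u)"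
    and "Im (h_centred M u) \<le> 0" and "Im u * cmod (h_centred M u) \<le> var M"
    and "Re u = 0 \<Longrightarrow> AE t in M. 0 \<le> t \<Longrightarrow> Re (h_centred M u) \<le> 0"
proof -
  have far: "AE t in M. Im u \<le> cmod (u - of_real t)"
  proof (rule AE_I2)
    show "Im u \<le> cmod (u - of_real t)" for t
      using abs_Im_le_cmod[of "u - of_real t"] by simp
  qed
  obtain N m where Nm: "0 \<le> N" "h_centred M u = cnj u * of_real N - of_real m"
    "(cmod (h_centred M u))\<^sup>2 \<le> var M * N" "(AE t in M. 0 \<le> t) \<longrightarrow> 0 \<le> m"
    using h_centred_resolvent[OF u far sq G_transform_nonzero_upper[OF less_imp_neq[OF u, symmetric]]]
    by (elim exE conjE) (rule that; assumption)
  have v: "0 \<le> var M" by (simp add: var_def)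
  have im: "Im (h_centred M u) = - (Im u * N)" by (simp add: Nm(2))
  then show "Im (h_centred M u) \<le> 0" using Nm u by simp
  show *: "Im u * (cmod (h_centred M u))\<^sup>2 \<le> var M * - Im (h_centred M u)"
    using mult_left_mono[OF Nm(3), of "Im u"] u by (simp add: im algebra_simps)
  show "Im u * cmod (h_centred M u) \<le> var M"
  proof (cases "h_centred M u = 0")
    case True then show ?thesis using v by simp
  next
    case False
    have "(Im u * cmod (h_centred M u)) * cmod (h_centred M u) \<le> var M * cmod (h_centred M u)"
      using * abs_Im_le_cmod[of "h_centred M u"] v
      by (smt (verit) mult_left_mono mult.assoc power2_eq_square)
    then show ?thesis using False by simp
  qed
  show "Re (h_centred M u) \<le> 0" if "Re u = 0" "AE t in M. 0 \<le> t"
    using Nm(4) that by (simp add: Nm(2))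
qed

text \<open>For \<open>Re u \<le> 0\<close> and a support in \<open>[0,\<infinity>)\<close>, the real part of \<open>u W = \<bar>u\<bar>\<^sup>2 N - u m\<close> is at least \<open>\<bar>u\<bar>\<^sup>2 N\<close>.  So
  \<open>\<bar>u\<bar>\<close>, the distance from \<open>[0,\<infinity>)\<close>, takes the part that \<open>Im u\<close> has in the upper half-plane.\<close>
lemma h_centred_left:
  assumes sq: "integrable M (\<lambda>x. x\<^sup>2)" and pos: "AE t in M. 0 \<le> t"
    and u: "u \<notin> \<real>\<^sub>\<ge>\<^sub>0" "Re u \<le> 0"
  shows "cmod u * cmod (h_centred M u) \<le> var M"
proof -
  obtain d where d: "0 < d" "\<forall>t\<ge>0. d \<le> cmod (u - of_real t)"
    using dist_nonneg_reals[OF u(1)] by blast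
  have far: "AE t in M. d \<le> cmod (u - of_real t)" using pos by eventually_elim (use d in auto)
  define W where "W = h_centred M u"
  obtain N m where Nm: "0 \<le> N" "h_centred M u = cnj u * of_real N - of_real m"
    "(cmod (h_centred M u))\<^sup>2 \<le> var M * N" "(AE t in M. 0 \<le> t) \<longrightarrow> 0 \<le> m"
    using h_centred_resolvent[OF d(1) far sq G_transform_nonzero_slit[OF pos u(1)]]
    by (elim exE conjE) (rule that; assumption)
  note Nm = Nm[folded W_def]
  have v: "0 \<le> var M" by (simp add: var_def)
  have "u * W = of_real ((cmod u)\<^sup>2 * N) - u * of_real m"
    unfolding Nm(2) of_real_mult complex_norm_square by (simp add: algebra_simps)
  then have "Re (u * W) = (cmod u)\<^sup>2 * N - Re u * m"
    by (simp only: minus_complex.simps Re_complex_of_real) simp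
  moreover have "Re u * m \<le> 0" using Nm(4) pos u(2) by (simp add: mult_nonpos_nonneg)
  ultimately have "(cmod u)\<^sup>2 * N \<le> cmod u * cmod W"
    using complex_Re_le_cmod[of "u * W"] by (simp add: norm_mult)
  then have "(cmod u)\<^sup>2 * (cmod W)\<^sup>2 \<le> var M * (cmod u * cmod W)"
    using mult_left_mono[OF Nm(3), of "(cmod u)\<^sup>2"] mult_left_mono[OF _ v]
    by (smt (verit) mult.left_commute zero_le_power2)
  then have "(cmod u * cmod W) * (cmod u * cmod W) \<le> var M * (cmod u * cmod W)"
    by (simp add: power2_eq_square algebra_simps)
  then show ?thesis
    unfolding W_def[symmetric] using v
    by (cases "cmod u * cmod W = 0") (auto simp: mult_le_cancel_right)
qed

lemma h_centred_holomorphic: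
  assumes "open S" and d: "\<And>z. z \<in> S \<Longrightarrow> \<exists>d>0. AE t in M. d \<le> cmod (z - of_real t)"
    and "\<And>z. z \<in> S \<Longrightarrow> G_transform M z \<noteq> 0"
  shows "h_centred M holomorphic_on S"
proof -
  have "G_transform M holomorphic_on S"
    unfolding holomorphic_on_open[OF \<open>open S\<close>]
    using d G_transform_has_field_derivative by blast
  then show ?thesis
    unfolding h_centred_def[abs_def] F_transform_def[abs_def]
    using assms by (intro holomorphic_intros) auto
qed

lemma h_centred_holomorphic_upper:
  "h_centred M holomorphic_on halfplane 0"
proof (rule h_centred_holomorphic)
  show "open (halfplane 0)" by (simp add: halfplane_def open_halfspace_Im_gt)
  show "\<exists>d>0. AE t in M. d \<le> cmod (z - of_real t)" if "z \<in> halfplane 0" for z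
  proof (intro exI conjI AE_I2)
    show "Im z \<le> cmod (z - of_real t)" for t
      using abs_Im_le_cmod[of "z - of_real t"] by simp
  qed (use that in \<open>simp add: halfplane_def\<close>)
  show "G_transform M z \<noteq> 0" if "z \<in> halfplane 0" for z
    using that by (intro G_transform_nonzero_upper) (simp add: halfplane_def)
qed

lemma h_centred_holomorphic_slit:
  assumes pos: "AE t in M. 0 \<le> t"
  shows "h_centred M holomorphic_on - \<real>\<^sub>\<ge>\<^sub>0"
proof (rule h_centred_holomorphic)
  show "open (- \<real>\<^sub>\<ge>\<^sub>0 :: complex set)"
    using closed_nonneg_Reals_complex by (simp add: open_Compl)
  fix z :: complex assume z: "z \<in> - \<real>\<^sub>\<ge>\<^sub>0"
  then obtain d where d: "0 < d" "\<forall>t\<ge>0. d \<le> cmod (z - of_real t)"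
    using dist_nonneg_reals by (metis ComplD)
  have "AE t in M. d \<le> cmod (z - of_real t)" using pos by eventually_elim (use d in auto)
  then show "\<exists>d>0. AE t in M. d \<le> cmod (z - of_real t)" using d(1) by blast
  show "G_transform M z \<noteq> 0" using z pos by (intro G_transform_nonzero_slit) auto
qed

end

section \<open>Jacobi coefficients\<close>

text \<open>All claims come from \<open>u = \<i> T\<close> with \<open>T \<rightarrow> \<infinity>\<close>.  Both \<open>W = h_centred \<mu> u\<close> and \<open>\<gamma>0 / D u\<close> tend to \<open>0\<close>, hence \<open>\<beta>0\<close> is the
  mean.  Then \<open>\<gamma>0 = \<bar>W\<bar> \<bar>D u\<bar>\<close>, where \<open>\<bar>W\<bar> \<le> var \<mu> / T\<close> and \<open>\<bar>D u\<bar> ~ T\<close>.  Finally \<open>Re W \<le> 0\<close> on the imaginary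
  axis, so \<open>Re (D u) \<le> 0\<close> if \<open>\<gamma>0 > 0\<close>, and \<open>Re (D u) \<rightarrow> - \<beta>1\<close>.\<close>
lemma jacobi_coeffs_h_centred:
  assumes \<mu>: "real_distribution \<mu>" and pos: "AE t in \<mu>. 0 \<le> t"
    and sq: "integrable \<mu> (\<lambda>x. x\<^sup>2)" and J: "jacobi_coeffs \<mu> \<beta>0 \<gamma>0 \<beta>1 \<gamma>1"
  shows "\<exists>D. (\<forall>u. 0 < Im u \<longrightarrow> h_centred \<mu> u = \<gamma>0 / D u
        \<and> cmod (D u - (u - \<beta>1)) * Im u \<le> \<gamma>1)
    \<and> 0 \<le> \<gamma>0 \<and> \<gamma>0 \<le> var \<mu> \<and> (0 < \<gamma>0 \<longrightarrow> 0 \<le> \<beta>1)"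
proof -
  interpret real_distribution \<mu> by fact
  from J obtain \<nu> where \<gamma>: "0 \<le> \<gamma>0" "0 \<le> \<gamma>1" and \<nu>: "real_distribution \<nu>"
    and G: "\<And>z::complex. z \<in> halfplane 0 \<Longrightarrow> G_transform \<mu> z =
             1 / (z - complex_of_real \<beta>0 - \<gamma>0 / (z - complex_of_real \<beta>1 - \<gamma>1 * G_transform \<nu> z))"
    unfolding jacobi_coeffs_def by blast
  interpret N: real_distribution \<nu> by fact
  define D where "D u = u - complex_of_real \<beta>1 - \<gamma>1 * G_transform \<nu> u" for u :: complex
  have F: "F_transform \<mu> u = u - complex_of_real \<beta>0 - \<gamma>0 / D u" if "0 < Im u" for u
    using G[of u] that by (simp add: F_transform_def D_def halfplane_def)
  have D1: "cmod (D u - (u - \<beta>1)) * Im u \<le> \<gamma>1" if u: "0 < Im u" for u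
  proof -
    have "cmod (G_transform \<nu> u) \<le> 1 / Im u"
    proof (rule N.norm_G_transform_le[OF u], rule AE_I2)
      show "Im u \<le> cmod (u - of_real t)" for t
        using abs_Im_le_cmod[of "u - of_real t"] by simp
    qed
    then have "\<gamma>1 * (cmod (G_transform \<nu> u) * Im u) \<le> \<gamma>1 * 1"
      using u \<gamma> by (intro mult_left_mono) (auto simp: field_simps)
    then show ?thesis using \<gamma> by (simp add: D_def norm_mult mult.assoc)
  qed
  define v where "v = var \<mu>"
  have v: "0 \<le> v" by (simp add: v_def var_def)
  define a where "a T = D (\<i> * of_real T)" for T :: real
  define w where "w T = h_centred \<mu> (\<i> * of_real T)" for T
  have aT: "cmod (a T - (\<i> * of_real T - \<beta>1)) \<le> \<gamma>1 / T" if "0 < T" for T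
    using D1[of "\<i> * of_real T"] that by (simp add: a_def field_simps)
  have wT: "cmod (w T) \<le> v / T" if "0 < T" for T
    using h_centred_upper(3)[OF sq, of "\<i> * of_real T"] that by (simp add: w_def v_def field_simps)
  have w0: "Re (w T) \<le> 0" if "0 < T" for T
    using h_centred_upper(4)[OF sq, of "\<i> * of_real T"] that pos by (simp add: w_def)
  have wF: "w T = \<beta>0 - mean \<mu> + \<gamma>0 / a T" if "0 < T" for T
    using F[of "\<i> * of_real T"] that by (simp add: w_def a_def h_centred_def algebra_simps)
  have lim1: "((\<lambda>T. 1 / T) \<longlongrightarrow> (0::real)) at_top"
    by (rule tendsto_divide_0[OF tendsto_const]) (simp add: filterlim_at_top_imp_at_infinity filterlim_ident)
  have small: "(f \<longlongrightarrow> 0) at_top" if "\<And>T. 0 < T \<Longrightarrow> cmod (f T) \<le> c / T"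
    for f :: "real \<Rightarrow> complex" and c
  proof (rule tendsto_0_le[OF lim1])
    show "\<forall>\<^sub>F T in at_top. norm (f T) \<le> norm (1 / T) * c"
      using eventually_gt_at_top[of 0] by eventually_elim (use that in auto)
  qed
  have aTl: "((\<lambda>T. a T - (\<i> * of_real T - \<beta>1)) \<longlongrightarrow> 0) at_top" using aT by (rule small)
  have wl: "(w \<longlongrightarrow> 0) at_top" using wT by (rule small)
  have iT: "((\<lambda>T. 1 / of_real T) \<longlongrightarrow> (0::complex)) at_top"
  proof (rule small)
    show "cmod (1 / of_real T) \<le> 1 / T" if "0 < T" for T
      using that by (simp add: norm_divide)
  qed
  have aTi: "((\<lambda>T. a T / of_real T) \<longlongrightarrow> \<i>) at_top"
  proof -
    have "((\<lambda>T. (a T - (\<i> * of_real T - \<beta>1)) * (1 / of_real T) + \<i> - complex_of_real \<beta>1 * (1 / of_real T))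
        \<longlongrightarrow> 0 * 0 + \<i> - complex_of_real \<beta>1 * 0) at_top"
      by (intro tendsto_add tendsto_diff tendsto_mult tendsto_const aTl iT)
    moreover have "\<forall>\<^sub>F T in at_top. (a T - (\<i> * of_real T - \<beta>1)) * (1 / of_real T) + \<i> - complex_of_real \<beta>1 * (1 / of_real T)
        = a T / of_real T"
      using eventually_gt_at_top[of 0] by eventually_elim (simp add: diff_divide_distrib)
    ultimately show ?thesis by (simp add: tendsto_cong)
  qed
  have ia: "((\<lambda>T. \<gamma>0 / a T) \<longlongrightarrow> 0) at_top"
  proof -
    have "((\<lambda>T. complex_of_real \<gamma>0 * (1 / of_real T) / (a T / of_real T)) \<longlongrightarrow> complex_of_real \<gamma>0 * 0 / \<i>) at_top"
      by (intro tendsto_divide tendsto_mult tendsto_const iT aTi) auto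
    moreover have "\<forall>\<^sub>F T in at_top. complex_of_real \<gamma>0 * (1 / of_real T) / (a T / of_real T) = \<gamma>0 / a T"
      using eventually_gt_at_top[of 0] by eventually_elim simp
    ultimately show ?thesis
      unfolding mult_zero_right div_0 by (rule Lim_transform_eventually)
  qed
  have \<beta>0: "\<beta>0 = mean \<mu>"
  proof -
    have "((\<lambda>T. w T - \<gamma>0 / a T) \<longlongrightarrow> 0 - 0) at_top" by (intro tendsto_intros wl ia)
    moreover have "\<forall>\<^sub>F T in at_top. w T - \<gamma>0 / a T = of_real (\<beta>0 - mean \<mu>)"
      using eventually_gt_at_top[of 0] by eventually_elim (simp add: wF)
    ultimately have "((\<lambda>T::real. complex_of_real (\<beta>0 - mean \<mu>)) \<longlongrightarrow> 0) at_top"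
      by (simp add: tendsto_cong)
    then have "complex_of_real (\<beta>0 - mean \<mu>) = 0"
      by (simp add: tendsto_const_iff)
    then show ?thesis by simp
  qed
  have h: "h_centred \<mu> u = \<gamma>0 / D u" if "0 < Im u" for u
    using F[OF that] by (simp add: h_centred_def \<beta>0)
  have w: "w T = \<gamma>0 / a T" if "0 < T" for T using wF[OF that] by (simp add: \<beta>0)
  have a0: "\<forall>\<^sub>F T in at_top. a T \<noteq> 0"
    using tendsto_imp_eventually_ne[OF aTi, of 0] by (rule eventually_mono) auto
  have "\<gamma>0 \<le> v"
  proof -
    have "((\<lambda>T. v * cmod (a T / of_real T)) \<longlongrightarrow> v * cmod \<i>) at_top"
      by (intro tendsto_intros aTi)
    moreover have "\<forall>\<^sub>F T in at_top. \<gamma>0 \<le> v * cmod (a T / of_real T)"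
      using eventually_gt_at_top[of 0] a0
    proof eventually_elim
      case (elim T)
      have "\<gamma>0 = cmod (w T) * cmod (a T)" using elim \<gamma> by (simp add: w norm_divide)
      also have "\<dots> \<le> (v / T) * cmod (a T)" using wT elim by (intro mult_right_mono) auto
      finally show ?case using elim by (simp add: norm_divide)
    qed
    ultimately show ?thesis using tendsto_lowerbound by fastforce
  qed
  moreover have "0 \<le> \<beta>1" if g0: "0 < \<gamma>0"
  proof -
    have "((\<lambda>T. Re (a T - (\<i> * of_real T - \<beta>1)) - \<beta>1) \<longlongrightarrow> Re 0 - \<beta>1) at_top"
      by (intro tendsto_intros aTl)
    then have "((\<lambda>T. Re (a T)) \<longlongrightarrow> - \<beta>1) at_top" by simp
    moreover have "\<forall>\<^sub>F T in at_top. Re (a T) \<le> 0"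
      using eventually_gt_at_top[of 0] a0
    proof eventually_elim
      case (elim T)
      have "Re (\<gamma>0 / a T) \<le> 0" using w0[of T] w[of T] elim by simp
      then have "\<gamma>0 * Re (a T) / ((Re (a T))\<^sup>2 + (Im (a T))\<^sup>2) \<le> 0"
        by (simp add: Re_divide)
      moreover have "0 < (Re (a T))\<^sup>2 + (Im (a T))\<^sup>2"
        using elim by (simp add: sum_power2_gt_zero_iff complex_eq_iff)
      ultimately have "\<gamma>0 * Re (a T) \<le> 0" by (simp add: divide_le_0_iff)
      then show ?case using g0 by (simp add: mult_le_0_iff)
    qed
    ultimately have "- \<beta>1 \<le> 0" using tendsto_upperbound by fastforce
    then show ?thesis by simp
  qed
  ultimately show ?thesis
    using h D1 \<gamma> unfolding v_def by (intro exI[of _ D] conjI allI impI) auto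
qed

section \<open>The threshold\<close>

text \<open>The bound itself, except where it vanishes; then \<open>\<mu>1\<close> is a point mass and every positive
  number serves.\<close>
definition K_choice :: "real \<Rightarrow> real \<Rightarrow> real \<Rightarrow> real \<Rightarrow> real" where
  "K_choice v1 v3 \<beta>1 \<gamma>1 = (let B = K_bound v1 v3 \<beta>1 \<gamma>1 in if 0 < B then B else 1)"

lemma K_choice_pos: "0 < K_choice v1 v3 \<beta>1 \<gamma>1"
  by (simp add: K_choice_def Let_def)

text \<open>This is the form in which the bound enters.  A number \<open>Y\<close> with \<open>y\<^sup>2 \<le> Y\<^sup>2 + 5/4 v3 Y\<close> (later \<open>Y\<close> is \<open>y\<close> divided by
  \<open>\<bar>w - F\<^sub>\<mu>\<^sub>3 w\<bar>\<close>) must be at least \<open>25 v1\<close> and at least \<open>5 \<rho>\<close>, where \<open>\<rho> = R/2\<close>, by monotonicity of the right-hand side.\<close>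
lemma K_choice_less_imp:
  assumes y: "K_choice v1 v3 \<beta>1 \<gamma>1 < y" and v: "0 < v1" "0 \<le> v3" and \<gamma>: "0 \<le> \<gamma>1"
  defines "\<rho> \<equiv> max (sqrt \<gamma>1) \<beta>1"
  shows "(25 * v1)\<^sup>2 + 5 / 4 * v3 * (25 * v1) \<le> y\<^sup>2"
    and "(5 * \<rho>)\<^sup>2 + 5 / 4 * v3 * (5 * \<rho>) \<le> y\<^sup>2"
proof -
  define S where "S = sqrt (5 * v1\<^sup>2 + 2 * v3 * v1)"
  define S' where "S' = sqrt ((2 * \<rho>)\<^sup>2 + 4 * (2 * \<rho>) * v3)"
  have \<rho>: "0 \<le> \<rho>" using \<gamma> by (simp add: \<rho>_def le_max_iff_disj)
  have S2: "S\<^sup>2 = 5 * v1\<^sup>2 + 2 * v3 * v1" using v by (simp add: S_def)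
  have S'2: "S'\<^sup>2 = 4 * \<rho>\<^sup>2 + 8 * \<rho> * v3" using v \<rho> by (simp add: S'_def power_mult_distrib)
  have S: "11 / 5 * v1 \<le> S"
    unfolding S_def using v by (intro real_le_rsqrt) (simp add: power2_eq_square)
  have S': "2 * \<rho> \<le> S'"
    unfolding S'_def using v \<rho> by (intro real_le_rsqrt) simp
  have B: "K_bound v1 v3 \<beta>1 \<gamma>1 = max (6 * (2 * v1 + S)) (2 * \<rho> + 3 / 2 * S')"
    unfolding K_bound_def R_const_def Let_def S_def S'_def \<rho>_def by simp
  have B0: "0 < K_bound v1 v3 \<beta>1 \<gamma>1" using v S by (simp add: B less_max_iff_disj)
  then have y1: "6 * (2 * v1 + S) < y" and y2: "2 * \<rho> + 3 / 2 * S' < y"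
    using y by (simp_all add: K_choice_def B)
  have "(25 * v1)\<^sup>2 + 5 / 4 * v3 * (25 * v1) \<le> 324 * v1\<^sup>2 + 72 * v1 * v3 + 144 * v1 * (11 / 5 * v1)"
  proof -
    have "0 \<le> v1 * v3" "0 \<le> v1 * v1" using v by auto
    moreover have "324 * v1\<^sup>2 + 72 * v1 * v3 + 144 * v1 * (11 / 5 * v1)
        - ((25 * v1)\<^sup>2 + 5 / 4 * v3 * (25 * v1)) = 79 / 5 * (v1 * v1) + 163 / 4 * (v1 * v3)"
      by (simp add: power2_eq_square algebra_simps)
    ultimately show ?thesis by linarith
  qed
  also have "\<dots> \<le> 324 * v1\<^sup>2 + 72 * v1 * v3 + 144 * v1 * S"
    using v S by (intro add_left_mono mult_left_mono) auto
  also have "\<dots> = (6 * (2 * v1 + S))\<^sup>2"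
    using S2 by (simp add: power2_eq_square algebra_simps)
  also have "\<dots> \<le> y\<^sup>2" using y1 v S by (intro power_mono) auto
  finally show "(25 * v1)\<^sup>2 + 5 / 4 * v3 * (25 * v1) \<le> y\<^sup>2" .
  have "(5 * \<rho>)\<^sup>2 + 5 / 4 * v3 * (5 * \<rho>) \<le> 13 * \<rho>\<^sup>2 + 18 * \<rho> * v3 + 6 * \<rho> * (2 * \<rho>)"
    using mult_nonneg_nonneg[of \<rho> v3] v \<rho> by (simp add: power2_eq_square algebra_simps)
  also have "\<dots> \<le> 13 * \<rho>\<^sup>2 + 18 * \<rho> * v3 + 6 * \<rho> * S'"
    using \<rho> S' by (intro add_left_mono mult_left_mono) auto
  also have "\<dots> = (2 * \<rho> + 3 / 2 * S')\<^sup>2"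
    using S'2 by (simp add: power2_eq_square algebra_simps)
  also have "\<dots> \<le> y\<^sup>2" using y2 \<rho> S' by (intro power_mono) auto
  finally show "(5 * \<rho>)\<^sup>2 + 5 / 4 * v3 * (5 * \<rho>) \<le> y\<^sup>2" .
qed

section \<open>Estimates for the iterated map\<close>

text \<open>With \<open>w = z + e\<close> one has \<open>w\<^sup>2 / z = z + 2 e + e\<^sup>2 / z\<close>, which moves \<open>z\<close> by at most \<open>2/5 Im z + 1/25 Im z\<close>;
  and \<open>\<bar>w\<bar> \<ge> 4/5 \<bar>z\<bar>\<close>.\<close>
lemma square_over_estimates:
  fixes z w :: complex
  assumes z: "0 < Im z" and w: "w \<in> ball z (Im z / 5)"
  shows "14 / 25 * Im z \<le> Im (w\<^sup>2 / z)" and "16 / 25 * cmod z \<le> cmod (w\<^sup>2 / z)"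
    and "4 / 5 * Im z \<le> Im w" and "w \<noteq> 0"
proof -
  define e where "e = w - z"
  have we: "w = z + e" by (simp add: e_def)
  have e: "cmod e \<le> Im z / 5" using w by (simp add: e_def dist_norm norm_minus_commute)
  have zy: "Im z \<le> cmod z" using abs_Im_le_cmod[of z] by simp
  have z0: "z \<noteq> 0" "0 < cmod z" using z by auto
  show imw: "4 / 5 * Im z \<le> Im w" using e abs_Im_le_cmod[of e] by (simp add: we)
  then show "w \<noteq> 0" using z by auto
  have "w\<^sup>2 / z = z + 2 * e + e\<^sup>2 / z" using z0 by (simp add: we power2_eq_square field_simps)
  moreover have "cmod (e\<^sup>2 / z) \<le> Im z / 25"
  proof -
    have "(cmod e)\<^sup>2 \<le> (Im z / 5)\<^sup>2" using e by (intro power_mono) auto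
    also have "\<dots> \<le> Im z / 25 * cmod z"
      using z zy mult_left_mono[of "Im z" "cmod z" "Im z / 25"] by (simp add: power2_eq_square)
    finally show ?thesis using z0 by (simp add: norm_divide norm_power divide_le_eq)
  qed
  ultimately show "14 / 25 * Im z \<le> Im (w\<^sup>2 / z)"
    using e abs_Im_le_cmod[of e] abs_Im_le_cmod[of "e\<^sup>2 / z"] by simp
  have "4 / 5 * cmod z \<le> cmod w"
    using e zy norm_triangle_ineq2[of z "-e"] by (simp add: we)
  then have "(4 / 5 * cmod z)\<^sup>2 \<le> (cmod w)\<^sup>2" by (intro power_mono) auto
  then show "16 / 25 * cmod z \<le> cmod (w\<^sup>2 / z)"
    using z0 by (simp add: norm_divide norm_mult le_divide_eq power2_eq_square)
qed

text \<open>The hypothesis says that \<open>1 + P\<close> lies in the disc of radius \<open>s\<close> about \<open>1 - \<i> s\<close>, so its modulus \<open>N\<close>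
  is at most \<open>s + sqrt (1 + s\<^sup>2)\<close>.  The second claim is that inequality without the root.\<close>
lemma norm_one_plus_disc:
  fixes P :: complex and s :: real
  assumes "(cmod P)\<^sup>2 \<le> 2 * s * - Im P" "0 \<le> s"
  shows "1 + P \<noteq> 0" and "(cmod (1 + P))\<^sup>2 \<le> 1 + 2 * s * cmod (1 + P)"
proof -
  show "1 + P \<noteq> 0"
  proof
    assume "1 + P = 0"
    then have "P = -1" by (simp add: add_eq_0_iff)
    with assms show False by simp
  qed
  have "(cmod (P + \<i> * s))\<^sup>2 \<le> s\<^sup>2"
    using assms unfolding cmod_power2 by (simp add: power2_eq_square algebra_simps)
  then have "cmod (P + \<i> * s) \<le> s" using assms power2_le_imp_le by blast
  then have N: "cmod (1 + P) - s \<le> cmod (1 - \<i> * s)"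
    using norm_triangle_ineq[of "P + \<i> * s" "1 - \<i> * s"] by (simp add: add.commute)
  show "(cmod (1 + P))\<^sup>2 \<le> 1 + 2 * s * cmod (1 + P)"
  proof (cases "cmod (1 + P) \<le> s")
    case True
    then have "(cmod (1 + P))\<^sup>2 \<le> s * cmod (1 + P)"
      by (simp add: power2_eq_square mult_right_mono)
    also have "\<dots> \<le> 1 + 2 * s * cmod (1 + P)"
      using assms by simp
    finally show ?thesis .
  next
    case False
    then have "(cmod (1 + P) - s)\<^sup>2 \<le> (cmod (1 - \<i> * s))\<^sup>2"
      using N by (intro power_mono) auto
    then show ?thesis unfolding cmod_power2[of "1 - \<i> * s"] by (simp add: power2_diff algebra_simps)
  qed
qed

locale subordination = M1: real_distribution \<mu>1 + M3: real_distribution \<mu>3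
  for \<mu>1 \<mu>3 :: "real measure" +
  fixes \<beta>0 \<gamma>0 \<beta>1 \<gamma>1 :: real
  assumes pos1: "AE x in \<mu>1. 0 \<le> x"
    and sq1: "integrable \<mu>1 (\<lambda>x. x\<^sup>2)" and sq3: "integrable \<mu>3 (\<lambda>x. x\<^sup>2)"
    and mean1: "mean \<mu>1 = 1" and mean3: "mean \<mu>3 = 1"
    and jacobi: "jacobi_coeffs \<mu>1 \<beta>0 \<gamma>0 \<beta>1 \<gamma>1"
begin

definition "K0 = K_choice (var \<mu>1) (var \<mu>3) \<beta>1 \<gamma>1"

lemma K0_pos: "0 < K0"
  unfolding K0_def by (rule K_choice_pos)

lemma var_nonneg: "0 \<le> var \<mu>1" "0 \<le> var \<mu>3"
  by (simp_all add: var_def)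

lemma h_fun_eq: "h_fun \<mu>1 w = 1 + h_centred \<mu>1 w" "h_fun \<mu>3 w = 1 + h_centred \<mu>3 w"
  by (simp_all add: h_fun_def h_centred_def mean1 mean3)

text \<open>The point at which \<open>T_map \<mu>1 \<mu>3 z\<close> evaluates \<open>h_fun \<mu>1\<close>, written so that it shows as a perturbation of \<open>w\<^sup>2 / z\<close>
  by the factor \<open>1 / h_fun \<mu>3 w\<close>.  This factor need not be close to \<open>1\<close>, since \<open>var \<mu>3 / Im z\<close> may be
  large if \<open>var \<mu>1\<close> and the Jacobi coefficients are small.\<close>
definition T_arg :: "complex \<Rightarrow> complex \<Rightarrow> complex" where
  "T_arg z w = w\<^sup>2 / z / h_fun \<mu>3 w"

lemma h_tilde_eq: "h_tilde \<mu>3 w = h_fun \<mu>3 w / w\<^sup>2"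
  by (simp add: h_tilde_def h_fun_def)

lemma T_arg_eq: "1 / (h_tilde \<mu>3 w * z) = T_arg z w"
  by (simp add: h_tilde_eq T_arg_def mult.commute)

lemma T_map_eq: "T_map \<mu>1 \<mu>3 z w = z + z * h_centred \<mu>1 (T_arg z w)"
  unfolding T_map_def T_arg_eq h_fun_eq by (simp add: distrib_left)

lemma h_fun_bounds:
  assumes "0 < Im w"
  shows "h_fun \<mu>3 w \<noteq> 0" and "Im (h_fun \<mu>3 w) \<le> 0" and "cmod (h_fun \<mu>3 w - 1) \<le> var \<mu>3 / Im w"
    and "(cmod (h_fun \<mu>3 w))\<^sup>2 \<le> 1 + var \<mu>3 / Im w * cmod (h_fun \<mu>3 w)"
proof -
  note U = M3.h_centred_upper[OF sq3 assms]
  have *: "(cmod (h_centred \<mu>3 w))\<^sup>2 \<le> 2 * (var \<mu>3 / Im w / 2) * - Im (h_centred \<mu>3 w)"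
    using U(1) assms by (simp add: field_simps)
  have "0 \<le> var \<mu>3 / Im w / 2" using assms var_nonneg by simp
  note D = norm_one_plus_disc[OF * this]
  show "h_fun \<mu>3 w \<noteq> 0" using D(1) by (simp add: h_fun_eq(2))
  show "(cmod (h_fun \<mu>3 w))\<^sup>2 \<le> 1 + var \<mu>3 / Im w * cmod (h_fun \<mu>3 w)" using D(2) by (simp add: h_fun_eq(2))
  show "Im (h_fun \<mu>3 w) \<le> 0" using U(2) by (simp add: h_fun_eq(2))
  show "cmod (h_fun \<mu>3 w - 1) \<le> var \<mu>3 / Im w" using U(3) assms by (simp add: h_fun_eq(2) field_simps)
qed

text \<open>By \<open>norm_one_plus_disc\<close> the number \<open>Y = y / \<bar>h_fun \<mu>3 w\<bar>\<close> satisfies \<open>y\<^sup>2 \<le> Y\<^sup>2 + 5/4 (var \<mu>3) Y\<close>; the factor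
  \<open>5/4\<close> is the price of \<open>Im w \<ge> 4/5 y\<close>.\<close>
lemma threshold:
  assumes y: "K0 < y" and v1: "0 < var \<mu>1" and w: "4 / 5 * y \<le> Im w" and \<gamma>: "0 \<le> \<gamma>1"
  shows "25 * var \<mu>1 \<le> y / cmod (h_fun \<mu>3 w)" and "5 * max (sqrt \<gamma>1) \<beta>1 \<le> y / cmod (h_fun \<mu>3 w)"
proof -
  define Y where "Y = y / cmod (h_fun \<mu>3 w)"
  have y0: "0 < y" using y K0_pos by linarith
  then have w0: "0 < Im w" using w by linarith
  note E = h_fun_bounds[OF w0]
  have N: "0 < cmod (h_fun \<mu>3 w)" using E(1) by simp
  have Y: "0 < Y" using y0 N by (simp add: Y_def)
  have yY: "y = Y * cmod (h_fun \<mu>3 w)" using N by (simp add: Y_def)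
  have "y\<^sup>2 = Y\<^sup>2 * (cmod (h_fun \<mu>3 w))\<^sup>2" unfolding yY by (simp add: power_mult_distrib)
  also have "\<dots> \<le> Y\<^sup>2 * (1 + var \<mu>3 / Im w * cmod (h_fun \<mu>3 w))"
    using E(4) by (intro mult_left_mono) auto
  also have "\<dots> = Y\<^sup>2 + var \<mu>3 * (y / Im w) * Y"
    unfolding yY by (simp add: power2_eq_square algebra_simps)
  also have "\<dots> \<le> Y\<^sup>2 + var \<mu>3 * (5 / 4) * Y"
    using w w0 Y var_nonneg by (intro add_left_mono mult_right_mono mult_left_mono) (auto simp: field_simps)
  finally have *: "y\<^sup>2 \<le> Y\<^sup>2 + 5 / 4 * var \<mu>3 * Y" by (simp add: mult_ac)
  have cmp: "c \<le> Y" if c: "c\<^sup>2 + 5 / 4 * var \<mu>3 * c \<le> y\<^sup>2" "0 \<le> c" for c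
  proof (rule ccontr)
    assume "\<not> c \<le> Y"
    then have "Y < c" by simp
    then have "Y\<^sup>2 < c\<^sup>2" using Y by (intro power_strict_mono) auto
    moreover have "5 / 4 * var \<mu>3 * Y \<le> 5 / 4 * var \<mu>3 * c"
      using \<open>Y < c\<close> var_nonneg by (intro mult_left_mono) auto
    ultimately show False using * c by linarith
  qed
  have \<rho>: "0 \<le> max (sqrt \<gamma>1) \<beta>1" using \<gamma> by (simp add: le_max_iff_disj)
  note K = K_choice_less_imp[OF y[unfolded K0_def] v1 var_nonneg(2) \<gamma>]
  show "25 * var \<mu>1 \<le> y / cmod (h_fun \<mu>3 w)" unfolding Y_def[symmetric] using K(1) v1 by (intro cmp) auto
  show "5 * max (sqrt \<gamma>1) \<beta>1 \<le> y / cmod (h_fun \<mu>3 w)" unfolding Y_def[symmetric] using K(2) \<rho> by (intro cmp) auto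
qed

text \<open>Let \<open>u\<close> be the argument of \<open>h_fun \<mu>1\<close> and put \<open>N = \<bar>h_fun \<mu>3 w\<bar>\<close>, \<open>Y = Im z / N\<close>, \<open>Z = \<bar>z\<bar> / N\<close>.  Since
  \<open>w\<^sup>2 / z\<close> is in the upper half-plane and \<open>h_fun \<mu>3 w\<close> is in the closed lower one, \<open>u\<close> keeps the distance
  \<open>14/25 Y\<close> from \<open>[0,\<infinity>)\<close>, although it may lie below the real axis.  For \<open>Re u \<le> 0\<close> the estimate
  \<open>h_centred_left\<close> suffices.  For \<open>Re u > 0\<close> the distance is \<open>\<bar>Im u\<bar>\<close>, and in the second step
  \<open>h_centred \<mu>1 u = \<gamma>0 / D u\<close> of the continued fraction \<open>D u\<close> differs from \<open>u\<close> by at most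
  \<open>\<beta>1 + \<gamma>1 / \<bar>Im u\<bar> \<le> Y/5 + Y/14\<close>, whereas \<open>\<bar>u\<bar> \<ge> 16/25 Z\<close> and \<open>Y \<le> Z\<close>.\<close>
lemma T_arg_estimates:
  assumes z: "z \<in> halfplane K0" and w: "w \<in> ball z (Im z / 5)"
  shows "T_arg z w \<notin> \<real>\<^sub>\<ge>\<^sub>0"
    and "9 / 25 * (cmod z * cmod (h_centred \<mu>1 (T_arg z w))) \<le> var \<mu>1 * cmod (h_fun \<mu>3 w)"
proof -
  define y where "y = Im z"
  have y: "K0 < y" using z by (simp add: y_def halfplane_def)
  then have y0: "0 < y" using K0_pos by linarith
  note B = square_over_estimates[OF y0[unfolded y_def] w, folded y_def]
  define \<zeta> where "\<zeta> = w\<^sup>2 / z"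
  define N where "N = cmod (h_fun \<mu>3 w)"
  define u where "u = T_arg z w"
  define Y where "Y = y / N"
  define Z where "Z = cmod z / N"
  have w0: "0 < Im w" using B(3) y0 by linarith
  note E = h_fun_bounds[OF w0]
  have N: "0 < N" using E(1) by (simp add: N_def)
  have Y: "0 < Y" using y0 N by (simp add: Y_def)
  have YZ: "Y \<le> Z" using N abs_Im_le_cmod[of z] by (simp add: Y_def Z_def y_def divide_right_mono)
  have u\<zeta>: "u = \<zeta> / h_fun \<mu>3 w" by (simp add: u_def T_arg_def \<zeta>_def)
  have far: "14 / 25 * Y \<le> cmod (u - of_real r)" if "0 \<le> r" for r
  proof -
    have "14 / 25 * y \<le> Im (\<zeta> - of_real r * h_fun \<mu>3 w)"
      using B(1) E(2) that mult_nonneg_nonpos[of r "Im (h_fun \<mu>3 w)"] by (simp add: \<zeta>_def)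
    also have "\<dots> \<le> cmod (\<zeta> - of_real r * h_fun \<mu>3 w)" using abs_Im_le_cmod by (rule order_trans[OF abs_ge_self])
    also have "\<zeta> - of_real r * h_fun \<mu>3 w = (u - of_real r) * h_fun \<mu>3 w" using E(1) by (simp add: u\<zeta> field_simps)
    finally have "14 / 25 * y \<le> cmod (u - of_real r) * N" by (simp only: norm_mult N_def)
    then show ?thesis using N by (simp add: Y_def divide_le_eq)
  qed
  show unn: "T_arg z w \<notin> \<real>\<^sub>\<ge>\<^sub>0"
  proof
    assume "T_arg z w \<in> \<real>\<^sub>\<ge>\<^sub>0"
    then obtain r where "u = of_real r" "0 \<le> r" unfolding u_def by (rule nonneg_Reals_cases)
    then show False using far[of r] Y by simp
  qed
  have uZ: "16 / 25 * Z \<le> cmod u"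
    using divide_right_mono[OF B(2), of N] N
    by (simp add: u\<zeta> Z_def norm_divide N_def[symmetric] \<zeta>_def[symmetric])
  define W where "W = h_centred \<mu>1 u"
  have "9 / 25 * (Z * cmod W) \<le> var \<mu>1"
  proof (cases "Re u \<le> 0")
    case True
    have "9 / 25 * Z * cmod W \<le> cmod u * cmod W"
      using uZ Y YZ by (intro mult_right_mono) auto
    also have "\<dots> \<le> var \<mu>1"
      unfolding W_def by (rule M1.h_centred_left[OF sq1 pos1 unn[folded u_def] True])
    finally show ?thesis by simp
  next
    case False
    \<comment> \<open>the Jacobi relation is given in the upper half-plane only; reflect \<open>u\<close> into it\<close>
    define u' where "u' = (if Im u > 0 then u else cnj u)"
    have Imu: "14 / 25 * Y \<le> \<bar>Im u\<bar>"
    proof -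
      have "u - of_real (Re u) = \<i> * Im u" by (simp add: complex_eq_iff)
      then show ?thesis using far[of "Re u"] False by (simp add: norm_mult)
    qed
    have u': "Im u' = \<bar>Im u\<bar>" "cmod u' = cmod u" by (auto simp: u'_def)
    have Wu': "cmod W = cmod (h_centred \<mu>1 u')" by (simp add: W_def u'_def M1.h_centred_cnj)
    have u'0: "0 < Im u'" using Imu Y u' by linarith
    show ?thesis
    proof (cases "var \<mu>1 = 0")
      case True
      then have "cmod W = 0"
        using M1.h_centred_upper(3)[OF sq1 u'0] u'0 by (simp add: Wu' mult_le_0_iff)
      then show ?thesis using True by simp
    next
      case False
      then have v1: "0 < var \<mu>1" using var_nonneg by simp
      obtain D :: "complex \<Rightarrow> complex" where D: "\<forall>u::complex. 0 < Im u \<longrightarrow> h_centred \<mu>1 u = \<gamma>0 / D u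
          \<and> cmod (D u - (u - \<beta>1)) * Im u \<le> \<gamma>1"
        and \<gamma>0: "0 \<le> \<gamma>0" "\<gamma>0 \<le> var \<mu>1" "0 < \<gamma>0 \<longrightarrow> 0 \<le> \<beta>1"
        using jacobi_coeffs_h_centred[OF M1.real_distribution_axioms pos1 sq1 jacobi]
        by (elim exE conjE) (rule that; assumption)
      have Du': "h_centred \<mu>1 u' = \<gamma>0 / D u'" "cmod (D u' - (u' - \<beta>1)) * Im u' \<le> \<gamma>1"
        using D u'0 by auto
      show ?thesis
      proof (cases "\<gamma>0 = 0")
        case True
        then show ?thesis using Du'(1) var_nonneg by (simp add: Wu')
      next
        case False
        then have \<beta>1: "0 \<le> \<beta>1" using \<gamma>0 by simp
        have \<gamma>1: "0 \<le> \<gamma>1" using jacobi by (simp add: jacobi_coeffs_def)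
        define \<rho> where "\<rho> = max (sqrt \<gamma>1) \<beta>1"
        note th = threshold[OF y v1 B(3) \<gamma>1, folded \<rho>_def, folded N_def, folded Y_def]
        have "sqrt \<gamma>1 \<le> \<rho>" by (simp add: \<rho>_def)
        then have "(sqrt \<gamma>1)\<^sup>2 \<le> \<rho>\<^sup>2" using \<gamma>1 by (intro power_mono) auto
        then have g\<rho>: "\<gamma>1 \<le> \<rho>\<^sup>2" using \<gamma>1 by simp
        have \<rho>: "\<beta>1 \<le> \<rho>" "0 \<le> \<rho>" using \<beta>1 by (auto simp: \<rho>_def)
        have err: "cmod (D u' - (u' - \<beta>1)) \<le> 1 / 14 * Y"
        proof -
          have "cmod (D u' - (u' - \<beta>1)) * (14 / 25 * Y) \<le> cmod (D u' - (u' - \<beta>1)) * Im u'"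
            using Imu u' by (intro mult_left_mono) auto
          also have "\<dots> \<le> \<gamma>1" by (rule Du'(2))
          also have "\<dots> \<le> \<rho>\<^sup>2" by (rule g\<rho>)
          also have "\<dots> \<le> (1 / 5 * Y)\<^sup>2" using th(2) \<rho> by (intro power_mono) auto
          also have "\<dots> = (1 / 14 * Y) * (14 / 25 * Y)" by (simp add: power2_eq_square)
          finally show ?thesis using Y by simp
        qed
        have "cmod u - \<beta>1 \<le> cmod (u' - \<beta>1)"
          using norm_triangle_ineq2[of u' \<beta>1] \<beta>1 u' by simp
        also have "\<dots> \<le> cmod (D u') + cmod (D u' - (u' - \<beta>1))"
          using norm_triangle_ineq4[of "D u'" "D u' - (u' - \<beta>1)"] by simp
        finally have Dlow: "9 / 25 * Z \<le> cmod (D u')"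
          using err uZ \<rho> th(2) YZ Y by linarith
        have "9 / 25 * Z * cmod W \<le> cmod (D u') * cmod W" using Dlow by (rule mult_right_mono) simp
        also have "\<dots> \<le> var \<mu>1"
          using Du'(1) \<gamma>0 by (cases "D u' = 0") (auto simp: Wu' norm_divide)
        finally show ?thesis by simp
      qed
    qed
  qed
  then show "9 / 25 * (cmod z * cmod (h_centred \<mu>1 (T_arg z w))) \<le> var \<mu>1 * cmod (h_fun \<mu>3 w)"
    using N by (simp add: Z_def W_def u_def N_def field_simps)
qed

text \<open>The first bound makes \<open>T_map \<mu>1 \<mu>3 z\<close> map the disc of radius \<open>Im z / 5\<close> into the concentric one of radius
  \<open>Im z / 9\<close>; the second one stays bounded as \<open>Im z \<rightarrow> \<infinity>\<close> and yields the asymptotics of the fixed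
  point.\<close>
lemma T_map_displacement:
  assumes z: "z \<in> halfplane K0" and w: "w \<in> ball z (Im z / 5)"
  shows "cmod (T_map \<mu>1 \<mu>3 z w - z) \<le> Im z / 9"
    and "cmod (T_map \<mu>1 \<mu>3 z w - z) \<le> 25 / 9 * var \<mu>1 * (1 + 5 / 4 * var \<mu>3 / Im z)"
proof -
  define y where "y = Im z"
  have y: "K0 < y" using z by (simp add: y_def halfplane_def)
  then have y0: "0 < y" using K0_pos by linarith
  note B = square_over_estimates[OF y0[unfolded y_def] w, folded y_def]
  have w0: "0 < Im w" using B(3) y0 by linarith
  note E = h_fun_bounds[OF w0]
  have N: "0 < cmod (h_fun \<mu>3 w)" using E(1) by simp
  have "9 / 25 * cmod (T_map \<mu>1 \<mu>3 z w - z) \<le> var \<mu>1 * cmod (h_fun \<mu>3 w)"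
    using T_arg_estimates(2)[OF z w] by (simp add: T_map_eq norm_mult)
  then have *: "cmod (T_map \<mu>1 \<mu>3 z w - z) \<le> 25 / 9 * (var \<mu>1 * cmod (h_fun \<mu>3 w))" by simp
  have "cmod (h_fun \<mu>3 w) \<le> 1 + var \<mu>3 / Im w" using E(3) norm_triangle_ineq[of "h_fun \<mu>3 w - 1" 1] by simp
  also have "\<dots> \<le> 1 + 5 / 4 * var \<mu>3 / y"
  proof -
    have "var \<mu>3 / Im w \<le> var \<mu>3 / (4 / 5 * y)"
      using B(3) y0 w0 var_nonneg by (intro divide_left_mono) auto
    then show ?thesis by (simp add: field_simps)
  qed
  finally have "var \<mu>1 * cmod (h_fun \<mu>3 w) \<le> var \<mu>1 * (1 + 5 / 4 * var \<mu>3 / y)"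
    by (rule mult_left_mono) (rule var_nonneg)
  then show "cmod (T_map \<mu>1 \<mu>3 z w - z) \<le> 25 / 9 * var \<mu>1 * (1 + 5 / 4 * var \<mu>3 / Im z)"
    using * by (simp add: y_def)
  show "cmod (T_map \<mu>1 \<mu>3 z w - z) \<le> Im z / 9"
  proof (cases "var \<mu>1 = 0")
    case True then show ?thesis using * y0 by (simp add: y_def)
  next
    case False
    then have v1: "0 < var \<mu>1" using var_nonneg by simp
    have "0 \<le> \<gamma>1" using jacobi by (simp add: jacobi_coeffs_def)
    from threshold(1)[OF y v1 B(3) this] have "25 * (var \<mu>1 * cmod (h_fun \<mu>3 w)) \<le> y"
      using N by (simp add: field_simps)
    then show ?thesis using * by (simp add: y_def)
  qed
qed

text \<open>Stated for two variable arguments, so as to cover both \<open>w \<mapsto> T_map \<mu>1 \<mu>3 z w\<close> for a fixed \<open>z\<close> and the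
  dependence of the iterates on \<open>z\<close>.\<close>
lemma T_map_holomorphic:
  assumes "open A" and f: "f holomorphic_on A" and g: "g holomorphic_on A"
    and dom: "\<And>x. x \<in> A \<Longrightarrow> f x \<in> halfplane K0 \<and> g x \<in> ball (f x) (Im (f x) / 5)"
  shows "(\<lambda>x. T_map \<mu>1 \<mu>3 (f x) (g x)) holomorphic_on A"
proof -
  have y0: "0 < Im (f x)" if "x \<in> A" for x
    using dom[OF that] K0_pos by (auto simp: halfplane_def)
  have g0: "0 < Im (g x)" if "x \<in> A" for x
    using square_over_estimates(3)[OF y0[OF that], of "g x"] dom[OF that] y0[OF that] by auto
  have "(h_centred \<mu>3 \<circ> g) holomorphic_on A"
    using g0 by (intro holomorphic_on_compose_gen[OF g M3.h_centred_holomorphic_upper])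
      (auto simp: halfplane_def)
  then have "(\<lambda>x. h_fun \<mu>3 (g x)) holomorphic_on A"
    unfolding h_fun_eq(2) o_def by (intro holomorphic_intros)
  moreover have "f x \<noteq> 0" "h_fun \<mu>3 (g x) \<noteq> 0" if "x \<in> A" for x
    using y0[OF that] h_fun_bounds(1)[OF g0[OF that]] by auto
  ultimately have "(\<lambda>x. T_arg (f x) (g x)) holomorphic_on A"
    unfolding T_arg_def using f g by (intro holomorphic_intros) simp_all
  then have "(h_centred \<mu>1 \<circ> (\<lambda>x. T_arg (f x) (g x))) holomorphic_on A"
    by (rule holomorphic_on_compose_gen[OF _ M1.h_centred_holomorphic_slit[OF pos1]])
      (use T_arg_estimates(1) dom in auto)
  then show ?thesis
    unfolding T_map_eq o_def using f by (intro holomorphic_intros)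
qed

end

section \<open>The subordination functions\<close>

text \<open>A function asymptotic to \<open>1 / (\<i> T)\<close> approaches \<open>0\<close> along the axis of the cones, whatever their
  opening.\<close>
lemma eventually_in_cone:
  fixes f :: "real \<Rightarrow> complex"
  assumes "0 < \<alpha>" "0 < \<epsilon>" and c: "((\<lambda>T. f T * (\<i> * of_real T)) \<longlongrightarrow> 1) at_top"
  shows "\<forall>\<^sub>F T in at_top. f T \<in> cone \<alpha> \<epsilon>"
proof -
  define c where "c = (\<lambda>T. f T * (\<i> * of_real T))"
  have cl: "(c \<longlongrightarrow> 1) at_top" using c by (simp add: c_def)
  have "((\<lambda>T. \<alpha> * \<bar>Re (c T)\<bar> - \<bar>Im (c T)\<bar>) \<longlongrightarrow> \<alpha> * \<bar>Re 1\<bar> - \<bar>Im 1\<bar>) at_top"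
    by (intro tendsto_intros cl)
  then have "\<forall>\<^sub>F T in at_top. 0 < \<alpha> * \<bar>Re (c T)\<bar> - \<bar>Im (c T)\<bar>"
    by (rule order_tendstoD(1)) (use assms in simp)
  moreover have "((\<lambda>T. cmod (c T) * (1 / T)) \<longlongrightarrow> cmod 1 * 0) at_top"
    by (intro tendsto_mult tendsto_norm cl)
       (rule tendsto_divide_0[OF tendsto_const], simp add: filterlim_at_top_imp_at_infinity filterlim_ident)
  then have "\<forall>\<^sub>F T in at_top. cmod (c T) * (1 / T) < \<epsilon>"
    by (rule order_tendstoD(2)) (use assms in simp)
  ultimately show ?thesis
    using eventually_gt_at_top[of 0]
  proof eventually_elim
    case (elim T)
    have "f T = - \<i> * c T / of_real T" using elim by (simp add: c_def mult_ac)
    then have *: "Re (f T) = Im (c T) / T" "Im (f T) = - Re (c T) / T" "cmod (f T) = cmod (c T) / T"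
      using elim by (auto simp: norm_divide norm_mult Re_divide_of_real Im_divide_of_real)
    have "\<bar>Im (c T)\<bar> / T < \<alpha> * \<bar>Re (c T)\<bar> / T" using elim by (intro divide_strict_right_mono) auto
    then show ?case using elim by (simp add: cone_def * abs_div)
  qed
qed

context subordination
begin

definition omega3 :: "complex \<Rightarrow> complex" where
  "omega3 z = lim (\<lambda>n. (T_map \<mu>1 \<mu>3 z ^^ n) z)"

lemma ball_invariant:
  assumes z: "z \<in> halfplane K0" and w: "w \<in> ball z (Im z / 5)"
  shows "w \<in> halfplane 0" and "h_tilde \<mu>3 w * z \<notin> \<real>\<^sub>\<ge>\<^sub>0" and "T_map \<mu>1 \<mu>3 z w \<in> ball z (Im z / 5)"
proof -
  have z0: "0 < Im z" using z K0_pos by (simp add: halfplane_def)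
  show "w \<in> halfplane 0" using square_over_estimates(3)[OF z0 w] z0 by (simp add: halfplane_def)
  show "h_tilde \<mu>3 w * z \<notin> \<real>\<^sub>\<ge>\<^sub>0"
  proof
    assume "h_tilde \<mu>3 w * z \<in> \<real>\<^sub>\<ge>\<^sub>0"
    then have "1 / (h_tilde \<mu>3 w * z) \<in> \<real>\<^sub>\<ge>\<^sub>0" by simp
    then show False using T_arg_estimates(1)[OF z w] by (simp add: T_arg_eq)
  qed
  show "T_map \<mu>1 \<mu>3 z w \<in> ball z (Im z / 5)"
    using T_map_displacement(1)[OF z w] z0 by (simp add: dist_norm norm_minus_commute)
qed

text \<open>\<open>45/53 = 2 r / (1 + r\<^sup>2)\<close> for the ratio \<open>r = 5/9\<close> of the radii \<open>Im z / 9\<close> and \<open>Im z / 5\<close>.\<close>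
lemma omega3_properties:
  assumes z: "z \<in> halfplane K0"
  shows "omega3 z \<in> cball z (Im z / 9)" and "T_map \<mu>1 \<mu>3 z (omega3 z) = omega3 z"
    and "w \<in> ball z (Im z / 5) \<Longrightarrow> cmod ((T_map \<mu>1 \<mu>3 z ^^ n) w - omega3 z) \<le> 2 / 5 * Im z * (45 / 53) ^ n"
    and "w \<in> ball z (Im z / 5) \<Longrightarrow> (\<lambda>n. (T_map \<mu>1 \<mu>3 z ^^ n) w) \<longlonglongrightarrow> omega3 z"
proof -
  have z0: "0 < Im z" using z K0_pos by (simp add: halfplane_def)
  have "T_map \<mu>1 \<mu>3 z holomorphic_on ball z (Im z / 5)"
    using T_map_holomorphic[of "ball z (Im z / 5)" "\<lambda>_. z" "\<lambda>x. x"] z by (simp add: eta_contract_eq)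
  moreover have "T_map \<mu>1 \<mu>3 z ` ball z (Im z / 5) \<subseteq> cball z (5 / 9 * (Im z / 5))"
    using T_map_displacement(1)[OF z] by (auto simp: dist_norm norm_minus_commute)
  ultimately obtain p where p: "p \<in> cball z (Im z / 9)" "T_map \<mu>1 \<mu>3 z p = p"
    and conv: "\<And>n x. x \<in> ball z (Im z / 5) \<Longrightarrow>
      cmod ((T_map \<mu>1 \<mu>3 z ^^ n) x - p) \<le> 2 / 5 * Im z * (45 / 53) ^ n"
    using iterates_disc_converge[of "T_map \<mu>1 \<mu>3 z" z "Im z / 5" "5 / 9"] z0
    by (auto simp: power2_eq_square)
  have lims: "(\<lambda>n. (T_map \<mu>1 \<mu>3 z ^^ n) x) \<longlonglongrightarrow> p" if "x \<in> ball z (Im z / 5)" for x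
  proof (rule LIM_zero_cancel, rule tendsto_0_le[where K = "2 / 5 * Im z"])
    show "(\<lambda>n. (45 / 53 :: real) ^ n) \<longlonglongrightarrow> 0" by (rule LIMSEQ_realpow_zero) auto
    show "\<forall>\<^sub>F n in sequentially. norm ((T_map \<mu>1 \<mu>3 z ^^ n) x - p) \<le> norm ((45 / 53 :: real) ^ n) * (2 / 5 * Im z)"
      using conv[OF that] by (intro always_eventually allI) (simp add: mult_ac)
  qed
  have "omega3 z = p" unfolding omega3_def using z0 by (intro limI lims) simp
  then show "omega3 z \<in> cball z (Im z / 9)" "T_map \<mu>1 \<mu>3 z (omega3 z) = omega3 z"
    "w \<in> ball z (Im z / 5) \<Longrightarrow> cmod ((T_map \<mu>1 \<mu>3 z ^^ n) w - omega3 z) \<le> 2 / 5 * Im z * (45 / 53) ^ n"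
    "w \<in> ball z (Im z / 5) \<Longrightarrow> (\<lambda>n. (T_map \<mu>1 \<mu>3 z ^^ n) w) \<longlonglongrightarrow> omega3 z"
    using p conv lims by auto
qed

lemma omega3_in_ball:
  assumes "z \<in> halfplane K0"
  shows "omega3 z \<in> ball z (Im z / 5)"
proof -
  have "0 < Im z" using assms K0_pos by (simp add: halfplane_def)
  then show ?thesis using omega3_properties(1)[OF assms] by simp
qed

lemma open_halfplane: "open (halfplane c)"
  by (simp add: halfplane_def open_halfspace_Im_gt)

lemma iterates_T_map_holomorphic:
  "(\<lambda>z. (T_map \<mu>1 \<mu>3 z ^^ n) z) holomorphic_on halfplane K0
    \<and> (\<forall>z\<in>halfplane K0. (T_map \<mu>1 \<mu>3 z ^^ n) z \<in> ball z (Im z / 5))"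
proof (induction n)
  case 0
  then show ?case using K0_pos by (auto simp: halfplane_def)
next
  case (Suc n)
  have "(\<lambda>z. T_map \<mu>1 \<mu>3 z ((T_map \<mu>1 \<mu>3 z ^^ n) z)) holomorphic_on halfplane K0"
    using Suc by (intro T_map_holomorphic open_halfplane) auto
  then show ?case using Suc ball_invariant(3) by auto
qed

text \<open>The rate of convergence of the iterates is the same for all \<open>z\<close>, so the convergence is locally
  uniform.\<close>
lemma omega3_holomorphic: "omega3 holomorphic_on halfplane K0"
proof (rule holomorphic_uniform_sequence[OF open_halfplane])
  show "(\<lambda>z. (T_map \<mu>1 \<mu>3 z ^^ n) z) holomorphic_on halfplane K0" for n
    using iterates_T_map_holomorphic by blast
  fix x assume "x \<in> halfplane K0"
  then obtain d where d: "0 < d" "cball x d \<subseteq> halfplane K0"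
    using open_halfplane open_contains_cball by blast
  have "uniform_limit (cball x d) (\<lambda>n z. (T_map \<mu>1 \<mu>3 z ^^ n) z) omega3 sequentially"
    unfolding uniform_limit_iff
  proof (intro allI impI)
    fix e :: real assume e: "0 < e"
    have "(\<lambda>n. 2 / 5 * (Im x + d) * (45 / 53 :: real) ^ n) \<longlonglongrightarrow> 2 / 5 * (Im x + d) * 0"
      by (intro tendsto_mult tendsto_const LIMSEQ_realpow_zero) auto
    then have "\<forall>\<^sub>F n in sequentially. 2 / 5 * (Im x + d) * (45 / 53 :: real) ^ n < e"
      using e by (intro order_tendstoD(2)) auto
    then show "\<forall>\<^sub>F n in sequentially. \<forall>z\<in>cball x d. dist ((T_map \<mu>1 \<mu>3 z ^^ n) z) (omega3 z) < e"
    proof eventually_elim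
      case (elim n)
      show ?case
      proof
        fix z assume z: "z \<in> cball x d"
        then have zk: "z \<in> halfplane K0" using d by blast
        then have z0: "0 < Im z" using K0_pos by (simp add: halfplane_def)
        have "Im z \<le> Im x + d"
          using z abs_Im_le_cmod[of "z - x"] by (simp add: dist_norm norm_minus_commute)
        then have "2 / 5 * Im z * (45 / 53) ^ n \<le> 2 / 5 * (Im x + d) * (45 / 53) ^ n"
          by (intro mult_right_mono mult_left_mono) auto
        moreover have "z \<in> ball z (Im z / 5)" using z0 by simp
        ultimately show "dist ((T_map \<mu>1 \<mu>3 z ^^ n) z) (omega3 z) < e"
          using omega3_properties(3)[OF zk, of z n] elim unfolding dist_norm by linarith
      qed
    qed
  qed
  then show "\<exists>d. 0 < d \<and> cball x d \<subseteq> halfplane K0 \<and>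
      uniform_limit (cball x d) (\<lambda>n z. (T_map \<mu>1 \<mu>3 z ^^ n) z) omega3 sequentially"
    using d by blast
qed

lemma omega3_asymptotics:
  "((\<lambda>T. omega3 (\<i> * of_real T) / (\<i> * of_real T)) \<longlongrightarrow> 1) at_top"
  "((\<lambda>T. h_fun \<mu>3 (omega3 (\<i> * of_real T))) \<longlongrightarrow> 1) at_top"
proof -
  have lim1: "((\<lambda>T. 1 / T) \<longlongrightarrow> (0::real)) at_top"
    by (rule tendsto_divide_0[OF tendsto_const]) (simp add: filterlim_at_top_imp_at_infinity filterlim_ident)
  have zk: "\<i> * of_real T \<in> halfplane K0" if "K0 < T" for T using that by (simp add: halfplane_def)
  define C where "C = 25 / 9 * var \<mu>1 * (1 + 5 / 4 * var \<mu>3 / K0)"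
  have "((\<lambda>T. omega3 (\<i> * of_real T) / (\<i> * of_real T) - 1) \<longlongrightarrow> 0) at_top"
  proof (rule tendsto_0_le[OF lim1])
    show "\<forall>\<^sub>F T in at_top. norm (omega3 (\<i> * of_real T) / (\<i> * of_real T) - 1) \<le> norm (1 / T) * C"
      using eventually_gt_at_top[of K0]
    proof eventually_elim
      case (elim T)
      define z where "z = \<i> * of_real T"
      have T: "0 < T" using elim K0_pos by linarith
      have z: "z \<in> halfplane K0" using zk[OF elim] by (simp add: z_def)
      have "cmod (omega3 z - z) \<le> 25 / 9 * var \<mu>1 * (1 + 5 / 4 * var \<mu>3 / T)"
        using T_map_displacement(2)[OF z omega3_in_ball[OF z]] omega3_properties(2)[OF z] by (simp add: z_def)
      also have "\<dots> \<le> C"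
        unfolding C_def using var_nonneg elim K0_pos T
        by (intro mult_left_mono add_left_mono divide_left_mono) auto
      finally have "cmod (omega3 z - z) / T \<le> C / T" using T by (simp add: divide_right_mono)
      moreover have "omega3 z / z - 1 = (omega3 z - z) / z" using T by (simp add: z_def diff_divide_distrib)
      ultimately show ?case using T by (simp add: z_def norm_divide norm_mult)
    qed
  qed
  then show "((\<lambda>T. omega3 (\<i> * of_real T) / (\<i> * of_real T)) \<longlongrightarrow> 1) at_top" by (rule LIM_zero_cancel)
  have "((\<lambda>T. h_fun \<mu>3 (omega3 (\<i> * of_real T)) - 1) \<longlongrightarrow> 0) at_top"
  proof (rule tendsto_0_le[OF lim1])
    show "\<forall>\<^sub>F T in at_top. norm (h_fun \<mu>3 (omega3 (\<i> * of_real T)) - 1) \<le> norm (1 / T) * (5 / 4 * var \<mu>3)"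
      using eventually_gt_at_top[of K0]
    proof eventually_elim
      case (elim T)
      define w where "w = omega3 (\<i> * of_real T)"
      have T: "0 < T" using elim K0_pos by linarith
      have w: "4 / 5 * T \<le> Im w"
        using square_over_estimates(3)[OF _ omega3_in_ball[OF zk[OF elim]]] T by (simp add: w_def)
      then have "cmod (h_fun \<mu>3 w - 1) \<le> var \<mu>3 / Im w" using T by (intro h_fun_bounds) auto
      also have "\<dots> \<le> var \<mu>3 / (4 / 5 * T)" using w T var_nonneg by (intro divide_left_mono) auto
      finally show ?case using T by (simp add: w_def field_simps)
    qed
  qed
  then show "((\<lambda>T. h_fun \<mu>3 (omega3 (\<i> * of_real T))) \<longlongrightarrow> 1) at_top" by (rule LIM_zero_cancel)
qed

definition omega1 :: "complex \<Rightarrow> complex" where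
  "omega1 z = 1 / (z * h_tilde \<mu>3 (omega3 z))"

lemma omega1_eq: "omega1 z = T_arg z (omega3 z)"
  unfolding omega1_def T_arg_eq[symmetric] by (simp add: mult.commute)

text \<open>The fixed-point equation, read for the reciprocals \<open>1 / \<omega>3\<close>, \<open>1 / \<omega>1\<close>: both are mapped to the same point by
  the respective \<open>eta\<close>, so inside the cones they are the values there of the inverse functions that define the
  \<open>\<Sigma>\<close>-transforms.\<close>
lemma eta_subordination:
  assumes z: "z \<in> halfplane K0"
  shows "eta \<mu>3 (1 / omega3 z) = omega3 z / (z * omega1 z)" and "eta \<mu>1 (1 / omega1 z) = omega3 z / (z * omega1 z)"
    and "omega1 z \<noteq> 0" and "omega3 z \<noteq> 0" and "z \<noteq> 0"
proof -
  have z0: "0 < Im z" using z K0_pos by (simp add: halfplane_def)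
  then show zn: "z \<noteq> 0" by auto
  note w = omega3_in_ball[OF z]
  have w0: "0 < Im (omega3 z)" using square_over_estimates(3)[OF z0 w] z0 by linarith
  show wn: "omega3 z \<noteq> 0" using w0 by auto
  show u: "omega1 z \<noteq> 0" using T_arg_estimates(1)[OF z w] by (auto simp: omega1_eq)
  have E: "h_fun \<mu>3 (omega3 z) \<noteq> 0" using h_fun_bounds(1)[OF w0] .
  have "eta \<mu>3 (1 / omega3 z) = h_fun \<mu>3 (omega3 z) / omega3 z"
    using wn by (simp add: eta_def h_fun_def)
  also have "\<dots> = omega3 z / (z * omega1 z)"
    using wn zn E by (simp add: omega1_eq T_arg_def power2_eq_square)
  finally show "eta \<mu>3 (1 / omega3 z) = omega3 z / (z * omega1 z)" .
  have "omega3 z = z * (1 + h_centred \<mu>1 (omega1 z))"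
    using omega3_properties(2)[OF z] by (simp add: T_map_eq omega1_eq distrib_left)
  then have "omega3 z / (z * omega1 z) = (1 + h_centred \<mu>1 (omega1 z)) / omega1 z"
    using zn by (metis mult_divide_mult_cancel_left)
  also have "\<dots> = eta \<mu>1 (1 / omega1 z)" by (simp add: eta_def h_centred_def mean1)
  finally show "eta \<mu>1 (1 / omega1 z) = omega3 z / (z * omega1 z)" by simp
qed

section \<open>Deconvolution\<close>

text \<open>High up on the imaginary axis, \<open>1 / \<omega>3\<close>, \<open>1 / \<omega>1\<close> and \<open>\<zeta> = \<omega>3 / (z \<omega>1)\<close> are all asymptotic to \<open>1 / z\<close>, hence in the
  cones on which the \<open>\<Sigma>\<close>-transforms are defined.  By injectivity the inverse functions of
  \<open>eta \<mu>3\<close> and \<open>eta \<mu>1\<close> take the values \<open>1 / \<omega>3\<close> and \<open>1 / \<omega>1\<close> at \<open>\<zeta>\<close>.  The product formula forces the value of the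
  third one to be \<open>\<zeta> (1 / \<omega>3) / (1 / \<omega>1) = 1 / z\<close>, that is \<open>eta \<mu>2 (1 / z) = \<zeta> = eta \<mu>3 (1 / \<omega>3)\<close>, which is the claim.\<close>
lemma deconvolution_imaginary_axis:
  assumes conv: "is_free_mult_conv \<mu>1 \<mu>2 \<mu>3"
  shows "\<forall>\<^sub>F T in at_top. F_transform \<mu>2 (\<i> * of_real T)
    = F_transform \<mu>3 (omega3 (\<i> * of_real T)) * (\<i> * of_real T) / omega3 (\<i> * of_real T)"
proof -
  obtain \<alpha> \<epsilon> \<alpha>' \<epsilon>' where pos: "0 < \<alpha>" "0 < \<epsilon>" "0 < \<alpha>'" "0 < \<epsilon>'"
    and inj: "\<And>\<rho>. \<rho> \<in> {\<mu>1, \<mu>2, \<mu>3} \<Longrightarrow> inj_on (eta \<rho>) (cone \<alpha> \<epsilon>)"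
    and sub: "\<And>\<rho>. \<rho> \<in> {\<mu>1, \<mu>2, \<mu>3} \<Longrightarrow> cone \<alpha>' \<epsilon>' \<subseteq> eta \<rho> ` cone \<alpha> \<epsilon>"
    and \<Sigma>: "\<And>z. z \<in> cone \<alpha>' \<epsilon>' \<Longrightarrow> Sigma_transform \<mu>3 (cone \<alpha> \<epsilon>) z =
             Sigma_transform \<mu>1 (cone \<alpha> \<epsilon>) z * Sigma_transform \<mu>2 (cone \<alpha> \<epsilon>) z"
    using conv unfolding is_free_mult_conv_def by metis
  define z where "z T = \<i> * complex_of_real T" for T
  have zk: "z T \<in> halfplane K0" if "K0 < T" for T using that by (simp add: z_def halfplane_def)
  note eta_T = eta_subordination[OF zk]
  have lim3: "((\<lambda>T. omega3 (z T) / z T) \<longlongrightarrow> 1) at_top" and limE: "((\<lambda>T. h_fun \<mu>3 (omega3 (z T))) \<longlongrightarrow> 1) at_top"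
    using omega3_asymptotics by (simp_all add: z_def)
  have "((\<lambda>T. 1 / (omega3 (z T) / z T)) \<longlongrightarrow> 1 / 1) at_top"
    by (intro tendsto_divide tendsto_const lim3) simp
  then have i3: "((\<lambda>T. 1 / omega3 (z T) * z T) \<longlongrightarrow> 1) at_top" by simp
  have "((\<lambda>T. h_fun \<mu>3 (omega3 (z T)) * (1 / omega3 (z T) * z T)\<^sup>2) \<longlongrightarrow> 1 * 1\<^sup>2) at_top"
    by (intro tendsto_mult tendsto_power limE i3)
  moreover have "\<forall>\<^sub>F T in at_top. h_fun \<mu>3 (omega3 (z T)) * (1 / omega3 (z T) * z T)\<^sup>2 = 1 / omega1 (z T) * z T"
    using eventually_gt_at_top[of K0]
    by eventually_elim (use eta_T in \<open>simp add: omega1_eq T_arg_def power2_eq_square\<close>)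
  ultimately have i1: "((\<lambda>T. 1 / omega1 (z T) * z T) \<longlongrightarrow> 1) at_top"
    using Lim_transform_eventually by fastforce
  have "((\<lambda>T. omega3 (z T) / z T * (1 / omega1 (z T) * z T)) \<longlongrightarrow> 1 * 1) at_top"
    by (intro tendsto_mult lim3 i1)
  then have i\<zeta>: "((\<lambda>T. omega3 (z T) / (z T * omega1 (z T)) * z T) \<longlongrightarrow> 1) at_top"
    by (simp add: mult_ac)
  have "\<forall>\<^sub>F T in at_top. 1 / omega3 (z T) \<in> cone \<alpha> \<epsilon>" "\<forall>\<^sub>F T in at_top. 1 / omega1 (z T) \<in> cone \<alpha> \<epsilon>"
    "\<forall>\<^sub>F T in at_top. omega3 (z T) / (z T * omega1 (z T)) \<in> cone \<alpha>' \<epsilon>'"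
    using pos i3 i1 i\<zeta> by (auto intro!: eventually_in_cone simp: z_def)
  then show ?thesis
    using eventually_gt_at_top[of K0]
  proof eventually_elim
    case (elim T)
    define \<zeta> where "\<zeta> = omega3 (z T) / (z T * omega1 (z T))"
    define a where "a \<rho> = inv_into (cone \<alpha> \<epsilon>) (eta \<rho>) \<zeta>" for \<rho>
    note \<eta> = eta_T[OF elim(4), folded \<zeta>_def]
    have \<zeta>: "\<zeta> \<in> cone \<alpha>' \<epsilon>'" using elim by (simp add: \<zeta>_def)
    have \<zeta>0: "\<zeta> \<noteq> 0" using \<eta> by (simp add: \<zeta>_def)
    have a3: "a \<mu>3 = 1 / omega3 (z T)"
      unfolding a_def \<eta>(1)[symmetric] using elim inj by (intro inv_into_f_f) auto
    have a1: "a \<mu>1 = 1 / omega1 (z T)"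
      unfolding a_def \<eta>(2)[symmetric] using elim inj by (intro inv_into_f_f) auto
    have "a \<mu>3 / \<zeta> = a \<mu>1 / \<zeta> * (a \<mu>2 / \<zeta>)"
      using \<Sigma>[OF \<zeta>] by (simp add: Sigma_transform_def a_def)
    then have "a \<mu>2 = a \<mu>3 * \<zeta> / a \<mu>1" using \<zeta>0 \<eta> by (simp add: a1 field_simps)
    also have "\<dots> = 1 / z T" using \<eta> by (simp add: a1 a3 \<zeta>_def)
    finally have "eta \<mu>2 (1 / z T) = \<zeta>"
      using f_inv_into_f[of \<zeta> "eta \<mu>2" "cone \<alpha> \<epsilon>"] sub[of \<mu>2] \<zeta> by (auto simp: a_def)
    then have "eta \<mu>2 (1 / z T) = eta \<mu>3 (1 / omega3 (z T))" by (simp add: \<eta>)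
    then have "F_transform \<mu>2 (z T) / z T = F_transform \<mu>3 (omega3 (z T)) / omega3 (z T)"
      using \<eta> by (simp add: eta_def diff_divide_distrib right_diff_distrib)
    then show ?case using \<eta> unfolding z_def[symmetric] by (simp add: field_simps)
  qed
qed

lemma F_transform_holomorphic:
  assumes "real_distribution \<mu>"
  shows "F_transform \<mu> holomorphic_on halfplane 0"
proof -
  interpret real_distribution \<mu> by fact
  have "(\<lambda>z. z - mean \<mu> - h_centred \<mu> z) holomorphic_on halfplane 0"
    using h_centred_holomorphic_upper by (intro holomorphic_intros)
  then show ?thesis by (simp add: h_centred_def)
qed

text \<open>Both sides are holomorphic on the half-plane, so the identity spreads from the imaginary axis.\<close>
lemma deconvolution:
  assumes \<mu>2: "real_distribution \<mu>2" and conv: "is_free_mult_conv \<mu>1 \<mu>2 \<mu>3"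
    and z: "z \<in> halfplane K0"
  shows "F_transform \<mu>2 z = F_transform \<mu>3 (omega3 z) * z * inverse (omega3 z)"
proof -
  define f where "f z = F_transform \<mu>2 z - F_transform \<mu>3 (omega3 z) * z / omega3 z" for z
  obtain T0 where T0: "\<And>T. T0 \<le> T \<Longrightarrow> f (\<i> * of_real T) = 0"
    using deconvolution_imaginary_axis[OF conv] unfolding eventually_at_top_linorder f_def by auto
  define T1 where "T1 = max T0 (K0 + 1)"
  have w0: "omega3 z \<in> halfplane 0" if "z \<in> halfplane K0" for z
    using ball_invariant(1)[OF that omega3_in_ball[OF that]] .
  have "f z = 0"
  proof (rule analytic_continuation[where f = f and w = z and S = "halfplane K0" and U = "(\<lambda>T. \<i> * of_real T) ` {T1..}"
        and \<xi> = "\<i> * of_real (T1 + 1)"])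
    have "(F_transform \<mu>3 \<circ> omega3) holomorphic_on halfplane K0"
      using w0 by (intro holomorphic_on_compose_gen[OF omega3_holomorphic
          F_transform_holomorphic[OF M3.real_distribution_axioms]]) auto
    moreover have "F_transform \<mu>2 holomorphic_on halfplane K0"
      by (rule holomorphic_on_subset[OF F_transform_holomorphic[OF \<mu>2]])
         (use K0_pos in \<open>auto simp: halfplane_def\<close>)
    ultimately show "f holomorphic_on halfplane K0"
      unfolding f_def o_def using omega3_holomorphic eta_subordination(4)
      by (intro holomorphic_intros) auto
    show "open (halfplane K0)" by (rule open_halfplane)
    show "connected (halfplane K0)"
      unfolding halfplane_def by (intro convex_connected convex_halfspace_Im_gt)
    show "(\<lambda>T. \<i> * complex_of_real T) ` {T1..} \<subseteq> halfplane K0"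
      by (auto simp: halfplane_def T1_def)
    show "\<i> * complex_of_real (T1 + 1) \<in> halfplane K0" by (auto simp: halfplane_def T1_def)
    show "\<i> * complex_of_real (T1 + 1) islimpt (\<lambda>T. \<i> * complex_of_real T) ` {T1..}"
      unfolding islimpt_approachable
    proof (intro allI impI)
      fix e :: real assume e: "0 < e"
      show "\<exists>x'\<in>(\<lambda>T. \<i> * complex_of_real T) ` {T1..}.
          x' \<noteq> \<i> * complex_of_real (T1 + 1) \<and> dist x' (\<i> * complex_of_real (T1 + 1)) < e"
      proof (rule bexI[of _ "\<i> * complex_of_real (T1 + 1 + e / 2)"])
        have "\<i> * complex_of_real (T1 + 1 + e / 2) - \<i> * complex_of_real (T1 + 1) = \<i> * of_real (e / 2)"
          by (simp add: algebra_simps)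
        then have "dist (\<i> * complex_of_real (T1 + 1 + e / 2)) (\<i> * complex_of_real (T1 + 1)) = e / 2"
          unfolding dist_norm using e by (simp only: norm_mult norm_ii norm_of_real)
        then show "\<i> * complex_of_real (T1 + 1 + e / 2) \<noteq> \<i> * complex_of_real (T1 + 1) \<and>
            dist (\<i> * complex_of_real (T1 + 1 + e / 2)) (\<i> * complex_of_real (T1 + 1)) < e"
          using e by (metis dist_self half_gt_zero less_irrefl field_sum_of_halves less_add_same_cancel1)
        show "\<i> * complex_of_real (T1 + 1 + e / 2) \<in> (\<lambda>T. \<i> * complex_of_real T) ` {T1..}"
          using e by (intro imageI) auto
      qed
    qed
    show "f x = 0" if "x \<in> (\<lambda>T. \<i> * complex_of_real T) ` {T1..}" for x
      using that T0 by (auto simp: T1_def)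
  qed (rule z)
  then show ?thesis by (simp add: f_def divide_inverse)
qed

end

section \<open>Existence and uniqueness of the subordination functions\<close>

lemma (in real_distribution) integrable_square_of_fourth:
  assumes "integrable M (\<lambda>x. x ^ 4)"
  shows "integrable M (\<lambda>x. x\<^sup>2)"
proof (rule square_integrable_imp_integrable)
  show "integrable M (\<lambda>x. (x\<^sup>2)\<^sup>2)" using assms by (simp add: power_mult[symmetric])
qed simp

theorem theorem1p4:
  shows "\<exists>K :: real \<Rightarrow> real \<Rightarrow> real \<Rightarrow> real \<Rightarrow> real.
    \<forall>(\<mu>1 :: real measure) (\<mu>3 :: real measure) \<beta>0 \<gamma>0 \<beta>1 \<gamma>1.
      real_distribution \<mu>1 \<and> (AE x in \<mu>1. 0 \<le> x) \<and> integrable \<mu>1 (\<lambda>x. x ^ 4) \<and>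
      real_distribution \<mu>3 \<and> integrable \<mu>3 (\<lambda>x. x\<^sup>2) \<and>
      mean \<mu>1 = 1 \<and> mean \<mu>3 = 1 \<and>
      jacobi_coeffs \<mu>1 \<beta>0 \<gamma>0 \<beta>1 \<gamma>1 \<longrightarrow>
      (let \<kappa> = K (var \<mu>1) (var \<mu>3) \<beta>1 \<gamma>1; B = K_bound (var \<mu>1) (var \<mu>3) \<beta>1 \<gamma>1 in
        0 < \<kappa> \<and> (0 < B \<longrightarrow> \<kappa> \<le> B) \<and>
        (\<exists>!\<omega>. case \<omega> of (\<omega>1, \<omega>3) \<Rightarrow>
           \<omega>1 \<in> halfplane \<kappa> \<rightarrow>\<^sub>E - \<real>\<^sub>\<ge>\<^sub>0 \<and>
           \<omega>3 \<in> halfplane \<kappa> \<rightarrow>\<^sub>E halfplane 0 \<and>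
           (\<forall>\<mu>2 :: real measure.
              real_distribution \<mu>2 \<and> integrable \<mu>2 (\<lambda>x. x\<^sup>2) \<and> mean \<mu>2 \<noteq> 0 \<and>
              is_free_mult_conv \<mu>1 \<mu>2 \<mu>3 \<longrightarrow>
              (\<forall>z\<in>halfplane \<kappa>.
                 F_transform \<mu>2 z = F_transform \<mu>3 (\<omega>3 z) * z * inverse (\<omega>3 z))) \<and>
           (\<forall>z\<in>halfplane \<kappa>. \<forall>w\<in>ball z (Im z / 5).
              (\<forall>n. (T_map \<mu>1 \<mu>3 z ^^ n) w \<in> halfplane 0 \<and>
                   h_tilde \<mu>3 ((T_map \<mu>1 \<mu>3 z ^^ n) w) * z \<notin> \<real>\<^sub>\<ge>\<^sub>0) \<and>
              (\<lambda>n. (T_map \<mu>1 \<mu>3 z ^^ n) w) \<longlonglongrightarrow> \<omega>3 z) \<and>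
           (\<forall>z\<in>halfplane \<kappa>. \<omega>1 z = 1 / (z * h_tilde \<mu>3 (\<omega>3 z)))))"
proof (rule exI[of _ K_choice], intro allI impI, elim conjE)
  fix \<mu>1 \<mu>3 :: "real measure" and \<beta>0 \<gamma>0 \<beta>1 \<gamma>1 :: real
  assume \<mu>1: "real_distribution \<mu>1" and \<mu>3: "real_distribution \<mu>3"
    and asms: "AE x in \<mu>1. 0 \<le> x" "integrable \<mu>1 (\<lambda>x. x ^ 4)" "integrable \<mu>3 (\<lambda>x. x\<^sup>2)"
      "mean \<mu>1 = 1" "mean \<mu>3 = 1" "jacobi_coeffs \<mu>1 \<beta>0 \<gamma>0 \<beta>1 \<gamma>1"
  interpret M1: real_distribution \<mu>1 by fact
  interpret M3: real_distribution \<mu>3 by fact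
  interpret subordination \<mu>1 \<mu>3 \<beta>0 \<gamma>0 \<beta>1 \<gamma>1
    by unfold_locales (use asms M1.integrable_square_of_fourth in auto)
  define H where "H = halfplane K0"
  define \<omega> where "\<omega> = (restrict omega1 H, restrict omega3 H)"
  have z0: "0 < Im z" if "z \<in> H" for z using that K0_pos by (simp add: H_def halfplane_def)
  have iter: "(T_map \<mu>1 \<mu>3 z ^^ n) w \<in> ball z (Im z / 5)"
    if "z \<in> H" "w \<in> ball z (Im z / 5)" for z w n
    by (induction n) (use that ball_invariant(3) in \<open>auto simp: H_def\<close>)
  define P where "P \<omega> \<longleftrightarrow> (case \<omega> of (\<omega>1, \<omega>3) \<Rightarrow>
           \<omega>1 \<in> H \<rightarrow>\<^sub>E - \<real>\<^sub>\<ge>\<^sub>0 \<and>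
           \<omega>3 \<in> H \<rightarrow>\<^sub>E halfplane 0 \<and>
           (\<forall>\<mu>2 :: real measure.
              real_distribution \<mu>2 \<and> integrable \<mu>2 (\<lambda>x. x\<^sup>2) \<and> mean \<mu>2 \<noteq> 0 \<and>
              is_free_mult_conv \<mu>1 \<mu>2 \<mu>3 \<longrightarrow>
              (\<forall>z\<in>H. F_transform \<mu>2 z = F_transform \<mu>3 (\<omega>3 z) * z * inverse (\<omega>3 z))) \<and>
           (\<forall>z\<in>H. \<forall>w\<in>ball z (Im z / 5).
              (\<forall>n. (T_map \<mu>1 \<mu>3 z ^^ n) w \<in> halfplane 0 \<and>
                   h_tilde \<mu>3 ((T_map \<mu>1 \<mu>3 z ^^ n) w) * z \<notin> \<real>\<^sub>\<ge>\<^sub>0) \<and>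
              (\<lambda>n. (T_map \<mu>1 \<mu>3 z ^^ n) w) \<longlonglongrightarrow> \<omega>3 z) \<and>
           (\<forall>z\<in>H. \<omega>1 z = 1 / (z * h_tilde \<mu>3 (\<omega>3 z))))" for \<omega> :: "(complex \<Rightarrow> complex) \<times> (complex \<Rightarrow> complex)"
  have ex: "P \<omega>"
    unfolding P_def \<omega>_def prod.case
  proof (intro conjI allI impI ballI)
    show "restrict omega1 H \<in> H \<rightarrow>\<^sub>E - \<real>\<^sub>\<ge>\<^sub>0"
      using T_arg_estimates(1) omega3_in_ball by (auto simp: omega1_eq H_def)
    show "restrict omega3 H \<in> H \<rightarrow>\<^sub>E halfplane 0"
      using ball_invariant(1) omega3_in_ball by (auto simp: H_def)
    fix z assume z: "z \<in> H"
    show "F_transform \<mu>2 z = F_transform \<mu>3 (restrict omega3 H z) * z * inverse (restrict omega3 H z)"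
      if "real_distribution \<mu>2 \<and> integrable \<mu>2 (\<lambda>x. x\<^sup>2) \<and> mean \<mu>2 \<noteq> 0 \<and> is_free_mult_conv \<mu>1 \<mu>2 \<mu>3" for \<mu>2
      using deconvolution[of \<mu>2 z] that z by (simp add: H_def)
    show "restrict omega1 H z = 1 / (z * h_tilde \<mu>3 (restrict omega3 H z))"
      using z by (simp add: omega1_def)
    fix w assume w: "w \<in> ball z (Im z / 5)"
    show "(T_map \<mu>1 \<mu>3 z ^^ n) w \<in> halfplane 0" "h_tilde \<mu>3 ((T_map \<mu>1 \<mu>3 z ^^ n) w) * z \<notin> \<real>\<^sub>\<ge>\<^sub>0" for n
      using ball_invariant(1,2)[OF _ iter[OF z w]] z by (auto simp: H_def)
    show "(\<lambda>n. (T_map \<mu>1 \<mu>3 z ^^ n) w) \<longlonglongrightarrow> restrict omega3 H z"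
      using omega3_properties(4)[OF _ w] z by (simp add: H_def)
  qed
  have uniq: "x = \<omega>" if x: "P x" for x
  proof -
    obtain a b where ab: "x = (a, b)" by (cases x)
    have X1: "a \<in> H \<rightarrow>\<^sub>E - \<real>\<^sub>\<ge>\<^sub>0" "b \<in> H \<rightarrow>\<^sub>E halfplane 0"
      and X2: "\<And>z w. z \<in> H \<Longrightarrow> w \<in> ball z (Im z / 5) \<Longrightarrow> (\<lambda>n. (T_map \<mu>1 \<mu>3 z ^^ n) w) \<longlonglongrightarrow> b z"
      and X3: "\<And>z. z \<in> H \<Longrightarrow> a z = 1 / (z * h_tilde \<mu>3 (b z))"
      using x[unfolded P_def ab prod.case] by blast+
    have b: "b z = omega3 z" if "z \<in> H" for z
    proof (rule LIMSEQ_unique)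
      have "z \<in> ball z (Im z / 5)" using z0[OF that] by simp
      then show "(\<lambda>n. (T_map \<mu>1 \<mu>3 z ^^ n) z) \<longlonglongrightarrow> b z" "(\<lambda>n. (T_map \<mu>1 \<mu>3 z ^^ n) z) \<longlonglongrightarrow> omega3 z"
        using X2 that omega3_properties(4)[of z z] by (auto simp: H_def)
    qed
    have "a z = omega1 z" if "z \<in> H" for z
      using X3[OF that] by (simp add: omega1_def b[OF that])
    with b have "a = restrict omega1 H" "b = restrict omega3 H"
      using X1 by (auto intro!: extensionalityI[where A = H] simp: PiE_iff)
    then show ?thesis by (simp add: ab \<omega>_def)
  qed
  have "\<exists>!\<omega>. P \<omega>"
    using ex uniq by (rule ex1I)
  moreover have "K0 \<le> K_bound (var \<mu>1) (var \<mu>3) \<beta>1 \<gamma>1" if "0 < K_bound (var \<mu>1) (var \<mu>3) \<beta>1 \<gamma>1"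
    using that by (simp add: K0_def K_choice_def)
  ultimately have "0 < K0 \<and> (0 < K_bound (var \<mu>1) (var \<mu>3) \<beta>1 \<gamma>1 \<longrightarrow> K0 \<le> K_bound (var \<mu>1) (var \<mu>3) \<beta>1 \<gamma>1)
      \<and> (\<exists>!\<omega>. P \<omega>)"
    using K0_pos by (intro conjI impI)
  then show "let \<kappa> = K_choice (var \<mu>1) (var \<mu>3) \<beta>1 \<gamma>1; B = K_bound (var \<mu>1) (var \<mu>3) \<beta>1 \<gamma>1 in
        0 < \<kappa> \<and> (0 < B \<longrightarrow> \<kappa> \<le> B) \<and>
        (\<exists>!\<omega>. case \<omega> of (\<omega>1, \<omega>3) \<Rightarrow>
           \<omega>1 \<in> halfplane \<kappa> \<rightarrow>\<^sub>E - \<real>\<^sub>\<ge>\<^sub>0 \<and>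
           \<omega>3 \<in> halfplane \<kappa> \<rightarrow>\<^sub>E halfplane 0 \<and>
           (\<forall>\<mu>2 :: real measure.
              real_distribution \<mu>2 \<and> integrable \<mu>2 (\<lambda>x. x\<^sup>2) \<and> mean \<mu>2 \<noteq> 0 \<and>
              is_free_mult_conv \<mu>1 \<mu>2 \<mu>3 \<longrightarrow>
              (\<forall>z\<in>halfplane \<kappa>.
                 F_transform \<mu>2 z = F_transform \<mu>3 (\<omega>3 z) * z * inverse (\<omega>3 z))) \<and>
           (\<forall>z\<in>halfplane \<kappa>. \<forall>w\<in>ball z (Im z / 5).
              (\<forall>n. (T_map \<mu>1 \<mu>3 z ^^ n) w \<in> halfplane 0 \<and>
                   h_tilde \<mu>3 ((T_map \<mu>1 \<mu>3 z ^^ n) w) * z \<notin> \<real>\<^sub>\<ge>\<^sub>0) \<and>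
              (\<lambda>n. (T_map \<mu>1 \<mu>3 z ^^ n) w) \<longlonglongrightarrow> \<omega>3 z) \<and>
           (\<forall>z\<in>halfplane \<kappa>. \<omega>1 z = 1 / (z * h_tilde \<mu>3 (\<omega>3 z))))"
    unfolding P_def H_def K0_def Let_def .
qed

end
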